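(* Let $n\in\mathbb{N}$. For $m\in\mathbb{N}$ let $T_m$ be the (injective, bounded) operator on $L^2((0,\infty))$ given by $$(T_mf)(x) := \frac{1}{x^m}\int_0^x\int_0^{t_1}\cdots\int_0^{t_{m-1}} f(u)\,du\,dt_{m-1}\cdots dt_1,\qquad x\in(0,\infty),$$ and let $T_m^{-1}$ denote its inverse defined on $\operatorname{ran}(T_m)$. Let $p_n(z)=\prod_{k=0}^{n-1}(z+k)$, $z\in\mathbb{C}$. Then $$T_n^{-1} = p_n\big(T_1^{-1}\big),$$ and $$\operatorname{dom}(T_n^{-1}) = \operatorname{dom}(T_1^{-n}) = \big\{g\in L^2((0,\infty)) \,\big|\, g\in AC^{(n-1)}_{loc}((0,\infty));\ x^jg^{(j)}\in L^2((0,\infty)),\ j=1,\dots,n\big\},$$ where $T_1^{-n}=(T_1^{-1})^n$ with its natural domain.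
   Context: $AC^{(n-1)}_{loc}((0,\infty))$ denotes the functions $g$ on $(0,\infty)$ such that $g,\dots,g^{(n-1)}$ are absolutely continuous on every compact subinterval of $(0,\infty)$. The polynomial $p_n(T_1^{-1})$ of the unbounded operator $T_1^{-1}$ is taken with its natural domain $\operatorname{dom}(T_1^{-n})$. *)

theory Defs
  imports "HOL-Analysis.Analysis" "HOL-Computational_Algebra.Polynomial"
begin

text \<open>Elements of L2((0,infinity)) are represented by functions real => complex;
  only their values on (0,infinity) matter, and they are identified up to a.e. equality.\<close>

definition L2 :: "(real \<Rightarrow> complex) \<Rightarrow> bool" where
  "L2 f \<longleftrightarrow> set_borel_measurable lborel {0<..} f \<and>
              set_integrable lborel {0<..} (\<lambda>x. (cmod (f x))^2)"

definition ae_eq :: "(real \<Rightarrow> complex) \<Rightarrow> (real \<Rightarrow> complex) \<Rightarrow> bool" where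
  "ae_eq f g \<longleftrightarrow> (AE x in lborel. x \<in> {0<..} \<longrightarrow> f x = g x)"

fun iint :: "nat \<Rightarrow> (real \<Rightarrow> complex) \<Rightarrow> real \<Rightarrow> complex" where
  "iint 0 f = f"
| "iint (Suc m) f = (\<lambda>x. integral {0..x} (iint m f))"

definition T :: "nat \<Rightarrow> (real \<Rightarrow> complex) \<Rightarrow> real \<Rightarrow> complex" where
  "T m f = (\<lambda>x. iint m f x / (complex_of_real x) ^ m)"

text \<open>Graph of the inverse operator T_m^{-1} (domain = ran T_m):
  Tinv m g h means g is in ran(T_m) and h represents T_m^{-1} g.\<close>
definition Tinv :: "nat \<Rightarrow> (real \<Rightarrow> complex) \<Rightarrow> (real \<Rightarrow> complex) \<Rightarrow> bool" where
  "Tinv m g h \<longleftrightarrow> L2 g \<and> L2 h \<and> ae_eq (T m h) g"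

fun opow :: "((real \<Rightarrow> complex) \<Rightarrow> (real \<Rightarrow> complex) \<Rightarrow> bool) \<Rightarrow> nat \<Rightarrow>
              (real \<Rightarrow> complex) \<Rightarrow> (real \<Rightarrow> complex) \<Rightarrow> bool" where
  "opow R 0 g h = (L2 g \<and> L2 h \<and> ae_eq h g)"
| "opow R (Suc k) g h = (\<exists>y. R g y \<and> opow R k y h)"

definition poly_op :: "complex poly \<Rightarrow> ((real \<Rightarrow> complex) \<Rightarrow> (real \<Rightarrow> complex) \<Rightarrow> bool) \<Rightarrow>
              (real \<Rightarrow> complex) \<Rightarrow> (real \<Rightarrow> complex) \<Rightarrow> bool" where
  "poly_op p R g h \<longleftrightarrow> L2 h \<and>
     (\<exists>ys. (\<forall>k\<le>degree p. opow R k g (ys k)) \<and>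
           ae_eq h (\<lambda>x. \<Sum>k\<le>degree p. coeff p k * ys k x))"

definition opdom :: "((real \<Rightarrow> complex) \<Rightarrow> (real \<Rightarrow> complex) \<Rightarrow> bool) \<Rightarrow> (real \<Rightarrow> complex) set" where
  "opdom R = {g. \<exists>h. R g h}"

definition pn :: "nat \<Rightarrow> complex poly" where
  "pn n = (\<Prod>k<n. [:of_nat k, 1:])"

definition ac_on :: "real \<Rightarrow> real \<Rightarrow> (real \<Rightarrow> complex) \<Rightarrow> bool" where
  "ac_on a b g \<longleftrightarrow> (\<forall>\<epsilon>>0. \<exists>\<delta>>0. \<forall>(N::nat) l r.
      (\<forall>i<N. a \<le> l i \<and> l i \<le> r i \<and> r i \<le> b) \<and>
      (\<forall>i<N. \<forall>j<N. i \<noteq> j \<longrightarrow> r i \<le> l j \<or> r j \<le> l i) \<and>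
      (\<Sum>i<N. r i - l i) < \<delta> \<longrightarrow> (\<Sum>i<N. cmod (g (r i) - g (l i))) < \<epsilon>)"

definition ac_loc :: "(real \<Rightarrow> complex) \<Rightarrow> bool" where
  "ac_loc g \<longleftrightarrow> (\<forall>a b. 0 < a \<and> a \<le> b \<longrightarrow> ac_on a b g)"

text \<open>The domain set of the theorem: g in L2, (a representative of) g lies in
  AC^(n-1)_loc((0,infinity)) with derivatives d j = g^(j) (d n the a.e. derivative of
  d (n-1)), and x^j g^(j) in L2 for j = 1..n.\<close>
definition Dn :: "nat \<Rightarrow> (real \<Rightarrow> complex) set" where
  "Dn n = {g. L2 g \<and> (\<exists>d :: nat \<Rightarrow> real \<Rightarrow> complex.
      ae_eq g (d 0) \<and>
      (\<forall>j<n. ac_loc (d j)) \<and>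
      (\<forall>j. Suc j < n \<longrightarrow> (\<forall>x>0. (d j has_vector_derivative d (Suc j) x) (at x))) \<and>
      (AE x in lborel. x > 0 \<longrightarrow> (d (n - 1) has_vector_derivative d n x) (at x)) \<and>
      (\<forall>j\<in>{1..n}. L2 (\<lambda>x. (complex_of_real x) ^ j * d j x)))}"

end

theory Submission
  imports Defs
begin

text \<open>
  Write \<open>A = T\<^sub>1\<inverse>\<close>, that is \<open>A g = (x g)'\<close>. Differentiating \<open>x T\<^sub>m\<^sub>+\<^sub>1 h\<close> gives
  \<open>(A + m) T\<^sub>m\<^sub>+\<^sub>1 h = T\<^sub>m h\<close>, where every \<open>T\<^sub>m h\<close> lies in \<open>L\<^sup>2\<close> because its modulus is at most the
  average of \<open>|h|\<close> over \<open>(0,x)\<close>, to which Hardy's inequality applies. Hence \<open>p\<^sub>n(A) T\<^sub>n h = h\<close>.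
  Conversely, applying the factors of \<open>p\<^sub>n(A)\<close> one by one to \<open>g\<close> produces a chain that satisfies the
  same recursion as the \<open>T\<^sub>m h\<close>; as each \<open>A + m\<close> is injective, the two chains agree and \<open>g = T\<^sub>n h\<close>.
  The description of \<open>dom A\<^sup>n\<close> follows by induction on \<open>n\<close> from \<open>A g = g + x g'\<close>; the boundary term
  \<open>lim x g(x)\<close> at 0 vanishes because \<open>1/x\<close> is not square integrable near 0.
\<close>

section \<open>Absolutely continuous functions\<close>

text \<open>Since \<open>h\<close> is merely square integrable, (A + m) T_{m+1} h = T_m h is proved
  in integrated form: x T_{m+1} h is the primitive of T_m h - m T_{m+1} h that vanishes at 0. For m
  = 0 this is the definition. For m >= 1 the function is classically differentiable on (0,infinity),
  and only its limit at 0 needs the bound by the average of |h|. Operators are graphs up to a.e.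
  equality, so p_n(A) is not factored as a composition. Instead a chain z_i = A^i g is fixed, and
  Y_m = (A + m) ... (A + n - 1) g is written as a combination of the z_i, with Y_n = g and Y_0 =
  p_n(A) g. The step A Y_{m+1} = Y_m - m Y_{m+1} applies A to a polynomial of degree below n only,
  so it stays inside the chain. Passing from g = T_n h down to Y_0 = h uses that A is single-valued;
  passing up from Y_0 = h to g uses that A + m is injective. In the domain, the n-th derivative
  exists only almost everywhere. This calls for both halves of Lebesgue's theory: primitives of L2
  functions are absolutely continuous and differentiable a.e., and an absolutely continuous function
  is recovered from its a.e. derivative.\<close>

lemma ac_onE:
  assumes "ac_on a b g" "0 < e"
  obtains \<delta> where "\<delta> > 0" "\<And>(N::nat) l r. (\<forall>i<N. a \<le> l i \<and> l i \<le> r i \<and> r i \<le> b) \<Longrightarrow>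
      (\<forall>i<N. \<forall>j<N. i \<noteq> j \<longrightarrow> r i \<le> l j \<or> r j \<le> l i) \<Longrightarrow> (\<Sum>i<N. r i - l i) < \<delta> \<Longrightarrow>
      (\<Sum>i<N. cmod (g (r i) - g (l i))) < e"
proof -
  obtain \<delta> where "\<delta> > 0" and \<delta>: "\<forall>(N::nat) l r. (\<forall>i<N. a \<le> l i \<and> l i \<le> r i \<and> r i \<le> b) \<and>
      (\<forall>i<N. \<forall>j<N. i \<noteq> j \<longrightarrow> r i \<le> l j \<or> r j \<le> l i) \<and> (\<Sum>i<N. r i - l i) < \<delta> \<longrightarrow>
      (\<Sum>i<N. cmod (g (r i) - g (l i))) < e"
    using assms(1)[unfolded ac_on_def, THEN spec, THEN mp, OF assms(2)] by (elim exE conjE)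
  show thesis
  proof (rule that[OF \<open>\<delta> > 0\<close>])
    fix N :: nat and l r :: "nat \<Rightarrow> real"
    assume "\<forall>i<N. a \<le> l i \<and> l i \<le> r i \<and> r i \<le> b"
      "\<forall>i<N. \<forall>j<N. i \<noteq> j \<longrightarrow> r i \<le> l j \<or> r j \<le> l i" "(\<Sum>i<N. r i - l i) < \<delta>"
    then show "(\<Sum>i<N. cmod (g (r i) - g (l i))) < e"
      using \<delta>[THEN spec[where x = N], THEN spec[where x = l], THEN spec[where x = r]] by simp
  qed
qed

text \<open>Reindexing by an arbitrary finite set is needed because the cells of a tagged division
  are indexed by pairs of a tag and an interval.\<close>

lemma ac_on_finite_family:
  assumes "ac_on a b g" "0 < e"
  shows "\<exists>\<delta>>0. \<forall>(S :: 'i set) l r. finite S \<and> (\<forall>i\<in>S. a \<le> l i \<and> l i \<le> r i \<and> r i \<le> b) \<and>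
      (\<forall>i\<in>S. \<forall>j\<in>S. i \<noteq> j \<longrightarrow> r i \<le> l j \<or> r j \<le> l i) \<and> (\<Sum>i\<in>S. r i - l i) < \<delta> \<longrightarrow>
      (\<Sum>i\<in>S. cmod (g (r i) - g (l i))) < e"
proof -
  obtain \<delta> where "\<delta> > 0" and \<delta>: "\<And>(N::nat) l r. (\<forall>i<N. a \<le> l i \<and> l i \<le> r i \<and> r i \<le> b) \<Longrightarrow>
      (\<forall>i<N. \<forall>j<N. i \<noteq> j \<longrightarrow> r i \<le> l j \<or> r j \<le> l i) \<Longrightarrow> (\<Sum>i<N. r i - l i) < \<delta> \<Longrightarrow>
      (\<Sum>i<N. cmod (g (r i) - g (l i))) < e"
    by (rule ac_onE[OF assms]) (rule that)
  show ?thesis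
  proof (intro exI[of _ \<delta>] conjI allI impI, fact, elim conjE)
    fix S :: "'i set" and l r
    assume S: "finite S" "\<forall>i\<in>S. a \<le> l i \<and> l i \<le> r i \<and> r i \<le> b"
      "\<forall>i\<in>S. \<forall>j\<in>S. i \<noteq> j \<longrightarrow> r i \<le> l j \<or> r j \<le> l i" "(\<Sum>i\<in>S. r i - l i) < \<delta>"
    obtain p where p: "bij_betw p {..<card S} S"
      using ex_bij_betw_nat_finite[OF S(1)] by (auto simp: atLeast0LessThan)
    have pS: "p i \<in> S" if "i < card S" for i
      using p that by (auto dest: bij_betwE)
    have pinj: "p i \<noteq> p j" if "i < card S" "j < card S" "i \<noteq> j" for i j
      using p that by (auto simp: bij_betw_def inj_on_def)
    have "(\<Sum>i<card S. cmod (g (r (p i)) - g (l (p i)))) < e"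
    proof (rule \<delta>)
      show "(\<Sum>i<card S. r (p i) - l (p i)) < \<delta>"
        using S(4) sum.reindex_bij_betw[OF p, of "\<lambda>i. r i - l i"] by simp
      show "\<forall>i<card S. a \<le> l (p i) \<and> l (p i) \<le> r (p i) \<and> r (p i) \<le> b"
        using S(2) pS by simp
      show "\<forall>i<card S. \<forall>j<card S. i \<noteq> j \<longrightarrow> r (p i) \<le> l (p j) \<or> r (p j) \<le> l (p i)"
        using S(3) pS pinj by simp
    qed
    then show "(\<Sum>i\<in>S. cmod (g (r i) - g (l i))) < e"
      using sum.reindex_bij_betw[OF p, of "\<lambda>i. cmod (g (r i) - g (l i))"] by simp
  qed
qed

text \<open>A single closure principle behind sums, products, constants and 1/x: it suffices to
  control increments by those of two functions already known to be absolutely continuous.\<close>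

lemma ac_on_dominated:
  assumes f: "ac_on a b f" and g: "ac_on a b g"
    and H: "\<And>x y. a \<le> x \<Longrightarrow> x \<le> y \<Longrightarrow> y \<le> b \<Longrightarrow>
      cmod (H y - H x) \<le> B * (cmod (f y - f x) + cmod (g y - g x))"
  shows "ac_on a b H"
  unfolding ac_on_def
proof (intro allI impI)
  fix e :: real assume "e > 0"
  \<comment> \<open>Chosen so that \<open>(\<bar>B\<bar> + 1) * (e' + e') = e\<close>; the
    \<open>+ 1\<close> keeps the factor positive whatever the sign of \<open>B\<close>.\<close>
  define e' where "e' = e / (2 * (\<bar>B\<bar> + 1))"
  have e': "e' > 0" using \<open>e > 0\<close> by (simp add: e'_def)
  obtain \<delta>1 where "\<delta>1 > 0" and \<delta>1: "\<And>(N::nat) l r. (\<forall>i<N. a \<le> l i \<and> l i \<le> r i \<and> r i \<le> b) \<Longrightarrow>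
      (\<forall>i<N. \<forall>j<N. i \<noteq> j \<longrightarrow> r i \<le> l j \<or> r j \<le> l i) \<Longrightarrow> (\<Sum>i<N. r i - l i) < \<delta>1 \<Longrightarrow>
      (\<Sum>i<N. cmod (f (r i) - f (l i))) < e'"
    by (rule ac_onE[OF f e']) (rule that)
  obtain \<delta>2 where "\<delta>2 > 0" and \<delta>2: "\<And>(N::nat) l r. (\<forall>i<N. a \<le> l i \<and> l i \<le> r i \<and> r i \<le> b) \<Longrightarrow>
      (\<forall>i<N. \<forall>j<N. i \<noteq> j \<longrightarrow> r i \<le> l j \<or> r j \<le> l i) \<Longrightarrow> (\<Sum>i<N. r i - l i) < \<delta>2 \<Longrightarrow>
      (\<Sum>i<N. cmod (g (r i) - g (l i))) < e'"
    by (rule ac_onE[OF g e']) (rule that)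
  show "\<exists>\<delta>>0. \<forall>(N::nat) l r.
      (\<forall>i<N. a \<le> l i \<and> l i \<le> r i \<and> r i \<le> b) \<and>
      (\<forall>i<N. \<forall>j<N. i \<noteq> j \<longrightarrow> r i \<le> l j \<or> r j \<le> l i) \<and>
      (\<Sum>i<N. r i - l i) < \<delta> \<longrightarrow> (\<Sum>i<N. cmod (H (r i) - H (l i))) < e"
  proof (intro exI[of _ "min \<delta>1 \<delta>2"] conjI allI impI, use \<open>\<delta>1 > 0\<close> \<open>\<delta>2 > 0\<close> in simp, elim conjE)
    fix N :: nat and l r
    assume *: "\<forall>i<N. a \<le> l i \<and> l i \<le> r i \<and> r i \<le> b"
      "\<forall>i<N. \<forall>j<N. i \<noteq> j \<longrightarrow> r i \<le> l j \<or> r j \<le> l i" "(\<Sum>i<N. r i - l i) < min \<delta>1 \<delta>2"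
    have 1: "(\<Sum>i<N. cmod (f (r i) - f (l i))) < e'" by (rule \<delta>1) (use * in auto)
    have 2: "(\<Sum>i<N. cmod (g (r i) - g (l i))) < e'" by (rule \<delta>2) (use * in auto)
    have "(\<Sum>i<N. cmod (H (r i) - H (l i))) \<le>
        (\<Sum>i<N. (\<bar>B\<bar> + 1) * (cmod (f (r i) - f (l i)) + cmod (g (r i) - g (l i))))"
    proof (rule sum_mono)
      fix i assume "i \<in> {..<N}"
      then have "cmod (H (r i) - H (l i)) \<le> B * (cmod (f (r i) - f (l i)) + cmod (g (r i) - g (l i)))"
        using * by (intro H) auto
      also have "\<dots> \<le> (\<bar>B\<bar> + 1) * (cmod (f (r i) - f (l i)) + cmod (g (r i) - g (l i)))"
        by (intro mult_right_mono) auto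
      finally show "cmod (H (r i) - H (l i)) \<le> \<dots>" .
    qed
    also have "\<dots> = (\<bar>B\<bar> + 1) * ((\<Sum>i<N. cmod (f (r i) - f (l i))) + (\<Sum>i<N. cmod (g (r i) - g (l i))))"
      by (simp add: sum.distrib flip: sum_distrib_left)
    also have "\<dots> < (\<bar>B\<bar> + 1) * (e' + e')"
      using 1 2 by (intro mult_strict_left_mono add_strict_mono) auto
    also have "\<dots> = e" by (simp add: e'_def divide_simps)
    finally show "(\<Sum>i<N. cmod (H (r i) - H (l i))) < e" .
  qed
qed

section \<open>Continuity and algebra of absolutely continuous functions\<close>

lemma ac_on_imp_continuous_on:
  assumes "ac_on a b g" shows "continuous_on {a..b} g"
  unfolding continuous_on_iff
proof (intro ballI allI impI)
  fix x e :: real assume x: "x \<in> {a..b}" and e: "0 < e"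
  obtain \<delta> where "\<delta> > 0" and \<delta>: "\<And>(N::nat) l r. (\<forall>i<N. a \<le> l i \<and> l i \<le> r i \<and> r i \<le> b) \<Longrightarrow>
      (\<forall>i<N. \<forall>j<N. i \<noteq> j \<longrightarrow> r i \<le> l j \<or> r j \<le> l i) \<Longrightarrow> (\<Sum>i<N. r i - l i) < \<delta> \<Longrightarrow>
      (\<Sum>i<N. cmod (g (r i) - g (l i))) < e"
    by (rule ac_onE[OF assms e]) (rule that)
  \<comment> \<open>A family of one interval; ordering its endpoints by \<open>min\<close> and
    \<open>max\<close> treats both sides of \<open>x\<close> at once.\<close>
  have "dist (g y) (g x) < e" if y: "y \<in> {a..b}" "dist y x < \<delta>" for y
    using \<delta>[of 1 "\<lambda>_. min x y" "\<lambda>_. max x y"] x y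
    by (auto simp: dist_norm min_def max_def norm_minus_commute abs_if split: if_splits)
  with \<open>\<delta> > 0\<close> show "\<exists>d>0. \<forall>y\<in>{a..b}. dist y x < d \<longrightarrow> dist (g y) (g x) < e" by blast
qed

lemma ac_loc_imp_continuous_on:
  assumes "ac_loc g" shows "continuous_on {0<..} g"
proof -
  have "isCont g x" if "x > 0" for x
  proof -
    have "continuous_on {x/2..2*x} g"
      using assms that by (intro ac_on_imp_continuous_on) (auto simp: ac_loc_def)
    then show ?thesis
      using that by (intro continuous_on_interior[of "{x/2..2*x}"]) auto
  qed
  then show ?thesis by (auto simp: continuous_on_eq_continuous_at)
qed

lemma ac_loc_add:
  assumes "ac_loc f" "ac_loc g" shows "ac_loc (\<lambda>x. f x + g x)"
  unfolding ac_loc_def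
proof (intro allI impI)
  fix a b :: real assume "0 < a \<and> a \<le> b"
  then have "ac_on a b f" "ac_on a b g" using assms by (auto simp: ac_loc_def)
  then show "ac_on a b (\<lambda>x. f x + g x)"
  proof (rule ac_on_dominated[where B = 1])
    show "cmod (f y + g y - (f x + g x)) \<le> 1 * (cmod (f y - f x) + cmod (g y - g x))" for x y
      using norm_triangle_ineq[of "f y - f x" "g y - g x"] by (simp add: algebra_simps)
  qed
qed

text \<open>Both factors are continuous, hence bounded on the compact interval, and the increment of
  the product splits as in the product rule.\<close>

lemma ac_loc_mult:
  assumes "ac_loc f" "ac_loc g" shows "ac_loc (\<lambda>x. f x * g x)"
  unfolding ac_loc_def
proof (intro allI impI)
  fix a b :: real assume "0 < a \<and> a \<le> b"
  then have ac: "ac_on a b f" "ac_on a b g" using assms by (auto simp: ac_loc_def)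
  have bdd: "\<exists>B. \<forall>x\<in>{a..b}. cmod (h x) \<le> B" if "ac_on a b h" for h
    using compact_imp_bounded[OF compact_continuous_image[OF ac_on_imp_continuous_on[OF that] compact_Icc]]
    by (auto simp: bounded_iff)
  obtain B1 where B1: "\<forall>x\<in>{a..b}. cmod (f x) \<le> B1" using bdd[OF ac(1)] by blast
  obtain B2 where B2: "\<forall>x\<in>{a..b}. cmod (g x) \<le> B2" using bdd[OF ac(2)] by blast
  show "ac_on a b (\<lambda>x. f x * g x)"
  proof (rule ac_on_dominated[OF ac, where B = "max B1 B2"])
    fix x y assume xy: "a \<le> x" "x \<le> y" "y \<le> b"
    have "f y * g y - f x * g x = (f y - f x) * g y + f x * (g y - g x)" by (simp add: algebra_simps)
    also have "cmod \<dots> \<le> cmod (f y - f x) * cmod (g y) + cmod (f x) * cmod (g y - g x)"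
      by (metis norm_mult norm_triangle_ineq)
    also have "\<dots> \<le> cmod (f y - f x) * max B1 B2 + max B1 B2 * cmod (g y - g x)"
    proof (intro add_mono mult_mono)
      show "cmod (g y) \<le> max B1 B2" "cmod (f x) \<le> max B1 B2"
        using B1 B2 xy by (auto simp: le_max_iff_disj)
      then show "0 \<le> max B1 B2" using norm_ge_zero order_trans by blast
    qed auto
    finally show "cmod (f y * g y - f x * g x) \<le> max B1 B2 * (cmod (f y - f x) + cmod (g y - g x))"
      by (simp add: algebra_simps)
  qed
qed

lemma ac_on_of_real: "ac_on a b complex_of_real"
  unfolding ac_on_def
proof (intro allI impI, rule_tac x = \<epsilon> in exI, intro conjI allI impI, assumption, elim conjE)
  fix e :: real and N :: nat and l r :: "nat \<Rightarrow> real"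
  assume "\<forall>i<N. a \<le> l i \<and> l i \<le> r i \<and> r i \<le> b" "(\<Sum>i<N. r i - l i) < e"
  moreover from this have "(\<Sum>i<N. cmod (of_real (r i) - of_real (l i))) = (\<Sum>i<N. r i - l i)"
    by (intro sum.cong) (simp_all flip: of_real_diff)
  ultimately show "(\<Sum>i<N. cmod (of_real (r i) - of_real (l i))) < e" by simp
qed

lemma ac_loc_const: "ac_loc (\<lambda>_. c)"
  unfolding ac_loc_def
  by (intro allI impI ac_on_dominated[OF ac_on_of_real ac_on_of_real, where B = 0]) simp

lemma ac_loc_of_real: "ac_loc complex_of_real"
  by (simp add: ac_loc_def ac_on_of_real)

lemma ac_loc_inverse: "ac_loc (\<lambda>x. 1 / complex_of_real x)"
  unfolding ac_loc_def
proof (intro allI impI)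
  fix a b :: real assume a: "0 < a \<and> a \<le> b"
  show "ac_on a b (\<lambda>x. 1 / complex_of_real x)"
  \<comment> \<open>On [a,b] the function 1/x is Lipschitz with constant 1/a^2. The embedding of the
    reals serves as both dominating functions.\<close>
  proof (rule ac_on_dominated[OF ac_on_of_real ac_on_of_real, where B = "1 / (a * a)"])
    fix x y assume xy: "a \<le> x" "x \<le> y" "y \<le> b"
    have "1 / complex_of_real y - 1 / complex_of_real x = of_real ((x - y) / (x * y))"
      using xy a by (simp add: field_simps)
    then have "cmod (1 / complex_of_real y - 1 / complex_of_real x) = (y - x) / (x * y)"
      using xy a by (simp only: norm_of_real) (auto simp: abs_mult)
    also have "\<dots> \<le> (y - x) / (a * a)"
      using xy a by (intro divide_left_mono mult_mono) auto
    also have "\<dots> \<le> 1 / (a * a) * (cmod (complex_of_real y - complex_of_real x) + cmod (complex_of_real y - complex_of_real x))"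
      using xy a by (simp flip: of_real_diff add: divide_simps)
    finally show "cmod (1 / complex_of_real y - 1 / complex_of_real x) \<le> \<dots>" .
  qed
qed

text \<open>Gauge argument: tags in the exceptional null set are confined to an open set of small measure,
  where absolute continuity bounds the increments of \<open>G\<close>.\<close>
theorem fundamental_theorem_of_calculus_ac:
  assumes ab: "a \<le> b" and ac: "ac_on a b G"
    and deriv: "AE x in lborel. a < x \<and> x < b \<longrightarrow> (G has_vector_derivative g x) (at x)"
  shows "(g has_integral G b - G a) {a..b}"
proof -
  obtain N where "{x \<in> space lborel. \<not> (a < x \<and> x < b \<longrightarrow> (G has_vector_derivative g x) (at x))} \<subseteq> N"
    "emeasure lborel N = 0" "N \<in> sets lborel"
    using deriv by (rule AE_E)
  then have N: "N \<in> null_sets lborel"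
    "{x. \<not> (a < x \<and> x < b \<longrightarrow> (G has_vector_derivative g x) (at x))} \<subseteq> N"
    by (auto intro: null_setsI)
  \<comment> \<open>With the endpoints put into the exceptional set, every other tag lies strictly
    inside (a,b), where the derivative is available.\<close>
  define E where "E = N \<union> {a, b}"
  have E_null: "E \<in> null_sets lborel" unfolding E_def by (rule null_sets.Un[OF N(1) finite_imp_null_set_lborel]) simp
  have negl: "negligible E"
    using E_null by (simp add: negligible_iff_null_sets null_sets_completionI)
  \<comment> \<open>The value 0 on \<open>E\<close> removes the Riemann term at an exceptional tag,
    so only the increment of \<open>G\<close> remains to be estimated there.\<close>
  define g0 where "g0 x = (if x \<in> E then 0 else g x)" for x
  have "(g0 has_integral G b - G a) {a..b}"
    unfolding has_integral_real
  proof (intro allI impI)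
    fix e :: real assume "e > 0"
    define e' where "e' = e / (2 * (b - a + 1))"
    have "e' > 0" using \<open>e > 0\<close> ab by (simp add: e'_def)
    obtain \<delta> where "\<delta> > 0" and \<delta>: "\<And>(S :: (real \<times> real set) set) l r. finite S \<Longrightarrow>
      (\<forall>i\<in>S. a \<le> l i \<and> l i \<le> r i \<and> r i \<le> b) \<Longrightarrow>
      (\<forall>i\<in>S. \<forall>j\<in>S. i \<noteq> j \<longrightarrow> r i \<le> l j \<or> r j \<le> l i) \<Longrightarrow> (\<Sum>i\<in>S. r i - l i) < \<delta> \<Longrightarrow>
      (\<Sum>i\<in>S. cmod (G (r i) - G (l i))) < e / 2"
      using ac_on_finite_family[OF ac, of "e/2", where 'i = "real \<times> real set"] \<open>e > 0\<close> by auto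
    obtain U where U: "open U" "E \<subseteq> U" "emeasure lborel (U - E) < ennreal \<delta>"
      by (rule outer_regular_lborel[OF _ \<open>\<delta> > 0\<close>, of E]) (use E_null in \<open>auto dest: null_setsD2\<close>)
    have "emeasure lborel U = emeasure lborel (U - E)"
      using E_null U(1) by (intro emeasure_Diff_null_set[symmetric]) auto
    then have U_small: "emeasure lborel U < ennreal \<delta>" using U by simp
    have "\<forall>x. \<exists>d>0. a < x \<and> x < b \<and> x \<notin> E \<longrightarrow> 
        (\<forall>y. norm (y - x) < d \<longrightarrow> norm (G y - G x - (y - x) *\<^sub>R g x) \<le> e' * norm (y - x))"
    proof
      fix x show "\<exists>d>0. a < x \<and> x < b \<and> x \<notin> E \<longrightarrow> 
        (\<forall>y. norm (y - x) < d \<longrightarrow> norm (G y - G x - (y - x) *\<^sub>R g x) \<le> e' * norm (y - x))"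
      proof (cases "a < x \<and> x < b \<and> x \<notin> E")
        case True
        then have "(G has_vector_derivative g x) (at x)" using N(2) by (auto simp: E_def)
        then show ?thesis
          using \<open>e' > 0\<close> unfolding has_vector_derivative_def has_derivative_at_alt by blast
      qed (auto intro: exI[of _ 1])
    qed
    then obtain \<rho> where \<rho>: "\<And>x. \<rho> x > 0"
      "\<And>x y. a < x \<Longrightarrow> x < b \<Longrightarrow> x \<notin> E \<Longrightarrow> norm (y - x) < \<rho> x \<Longrightarrow>
         norm (G y - G x - (y - x) *\<^sub>R g x) \<le> e' * norm (y - x)"
      by metis
    define \<gamma> where "\<gamma> x = (if x \<in> E then U else ball x (\<rho> x))" for x
    have "gauge \<gamma>" unfolding gauge_def \<gamma>_def using U \<rho>(1) by auto
    moreover have "norm ((\<Sum>(x,k)\<in>D. measure lborel k *\<^sub>R g0 x) - (G b - G a)) < e"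
      if D: "D tagged_division_of {a..b}" and fine: "\<gamma> fine D" for D
    proof -
      have finD: "finite D" using D by auto
      have K: "\<exists>u v. k = {u..v} \<and> u \<le> v \<and> x \<in> {u..v} \<and> a \<le> u \<and> v \<le> b" if "(x,k) \<in> D" for x k
        using tagged_division_ofD(2-4)[OF D that] by (fastforce simp: box_real)
      define \<phi> where "\<phi> = (\<lambda>(x::real,k). measure lborel k *\<^sub>R g0 x - (G (Sup k) - G (Inf k)))"
      \<comment> \<open>Good tags, exceptional tags on proper cells, exceptional tags on one-point
        cells. The last are split off because a one-point cell may lie inside another cell, which
        would break the separation demanded by \<open>ac_on\<close>; they contribute 0.\<close>
      define D1 where "D1 = {(x,k) \<in> D. x \<notin> E}"
      define D2 where "D2 = {(x,k) \<in> D. x \<in> E \<and> measure lborel k \<noteq> 0}"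
      define D3 where "D3 = {(x,k) \<in> D. x \<in> E \<and> measure lborel k = 0}"
      have fin: "finite D1" "finite D2" "finite D3"
        by (rule finite_subset[OF _ finD], auto simp: D1_def D2_def D3_def)+
      have "(\<Sum>(x,k)\<in>D. measure lborel k *\<^sub>R g0 x) - (G b - G a) =
          (\<Sum>(x,k)\<in>D. measure lborel k *\<^sub>R g0 x) - (\<Sum>(x,k)\<in>D. G (Sup k) - G (Inf k))"
        using additive_tagged_division_1[OF ab D, of G] by simp
      also have "\<dots> = sum \<phi> D"
        by (simp add: \<phi>_def sum_subtractf case_prod_unfold)
      also have "\<dots> = sum \<phi> (D1 \<union> D2 \<union> D3)"
        by (rule arg_cong[of D]) (auto simp: D1_def D2_def D3_def)
      also have "\<dots> = sum \<phi> D1 + sum \<phi> D2 + sum \<phi> D3"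
        using fin by (subst sum.union_disjoint; auto simp: D1_def D2_def D3_def)+
      also have "sum \<phi> D3 = 0"
      proof (rule sum.neutral, safe)
        fix x k assume xk: "(x,k) \<in> D3"
        then obtain u v where "k = {u..v}" "u \<le> v" using K[of x k] by (auto simp: D3_def)
        with xk show "\<phi> (x,k) = 0" by (auto simp: D3_def \<phi>_def)
      qed
      also have "norm (sum \<phi> D1 + sum \<phi> D2 + 0) \<le> norm (sum \<phi> D1) + norm (sum \<phi> D2)"
        using norm_triangle_ineq by simp
      also have "norm (sum \<phi> D1) \<le> e' * (b - a)"
      proof -
        have "norm (\<phi> (x,k)) \<le> e' * measure lborel k" if xk: "(x,k) \<in> D1" for x k
        proof -
          have xkD: "(x,k) \<in> D" "x \<notin> E" using xk by (auto simp: D1_def)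
          obtain u v where uv: "k = {u..v}" "u \<le> v" "x \<in> {u..v}" "a \<le> u" "v \<le> b"
            using K[OF xkD(1)] by blast
          have ax: "a < x" "x < b" using uv xkD(2) by (auto simp: E_def order.order_iff_strict)
          have sub: "k \<subseteq> ball x (\<rho> x)"
            using fineD[OF fine xkD(1)] xkD(2) by (simp add: \<gamma>_def)
          then have n: "norm (u - x) < \<rho> x" "norm (v - x) < \<rho> x"
            using uv subsetD[OF sub, of u] subsetD[OF sub, of v] by (simp_all add: dist_real_def abs_minus_commute)
          \<comment> \<open>Straddle argument: the tag lies between \<open>u\<close> and
            \<open>v\<close>, so the two first-order errors are at most \<open>e'\<close> times x -
            u and v - x, which add up to the length of the cell.\<close>
          have "\<phi> (x,k) = (G u - G x - (u - x) *\<^sub>R g x) - (G v - G x - (v - x) *\<^sub>R g x)"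
            using uv xkD by (simp add: \<phi>_def g0_def algebra_simps)
          also have "norm \<dots> \<le> e' * norm (u - x) + e' * norm (v - x)"
            using \<rho>(2)[OF ax xkD(2) n(1)] \<rho>(2)[OF ax xkD(2) n(2)] norm_triangle_ineq4 
            by (smt (verit))
          also have "\<dots> = e' * measure lborel k" using uv by (simp add: algebra_simps)
          finally show ?thesis .
        qed
        then have "norm (sum \<phi> D1) \<le> (\<Sum>(x,k)\<in>D1. e' * measure lborel k)"
          by (intro sum_norm_le) auto
        also have "\<dots> \<le> (\<Sum>(x,k)\<in>D. e' * measure lborel k)"
          using \<open>e' > 0\<close> finD by (intro sum_mono2) (auto simp: D1_def)
        also have "\<dots> = e' * (b - a)"
          using additive_content_tagged_division[of D a b] D ab
          by (simp add: case_prod_unfold flip: sum_distrib_left)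
        finally show ?thesis .
      qed
      also have "norm (sum \<phi> D2) < e / 2"
      proof -
        have D2: "\<exists>u v. k = {u..v} \<and> u < v \<and> x \<in> {u..v} \<and> a \<le> u \<and> v \<le> b \<and> {u..v} \<subseteq> U"
          if "(x,k) \<in> D2" for x k
          using K[of x k] that fine by (fastforce simp: D2_def fine_def \<gamma>_def)
        define l :: "real \<times> real set \<Rightarrow> real" where "l = (\<lambda>i. Inf (snd i))"
        define r :: "real \<times> real set \<Rightarrow> real" where "r = (\<lambda>i. Sup (snd i))"
        have lr: "a \<le> l i" "l i < r i" "r i \<le> b" "{l i..r i} \<subseteq> U" "snd i = {l i..r i}" if iD2: "i \<in> D2" for i
        proof -
          obtain u v where "snd i = {u..v} \<and> u < v \<and> fst i \<in> {u..v} \<and> a \<le> u \<and> v \<le> b \<and> {u..v} \<subseteq> U"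
            using D2[of "fst i" "snd i"] iD2 unfolding prod.collapse by blast
          then show "a \<le> l i" "l i < r i" "r i \<le> b" "{l i..r i} \<subseteq> U" "snd i = {l i..r i}"
            by (auto simp: l_def r_def)
        qed
        have disj: "r i \<le> l j \<or> r j \<le> l i" if "i \<in> D2" "j \<in> D2" "i \<noteq> j" for i j
        proof (rule ccontr)
          assume "\<not> ?thesis"
          then have *: "max (l i) (l j) < min (r i) (r j)" using lr(2) that by auto
          have "interior (snd i) \<inter> interior (snd j) = {}"
            using tagged_division_ofD(5)[OF D, of "fst i" "snd i" "fst j" "snd j"] that
            by (auto simp: D2_def prod_eq_iff)
          moreover have "(max (l i) (l j) + min (r i) (r j)) / 2 \<in> interior (snd i) \<inter> interior (snd j)"
            using * lr(5) that by (auto simp: field_simps)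
          ultimately show False by blast
        qed
        have "norm (sum \<phi> D2) \<le> (\<Sum>i\<in>D2. cmod (G (r i) - G (l i)))"
          by (intro sum_norm_le) (auto simp: D2_def \<phi>_def l_def r_def g0_def norm_minus_commute)
        also have "\<dots> < e / 2"
        proof (rule \<delta>)
          \<comment> \<open>The open cells are disjoint and contained in \<open>U\<close>, so their
            total length is below the \<open>\<delta>\<close> of absolute continuity.\<close>
          have "ennreal (\<Sum>i\<in>D2. r i - l i) = (\<Sum>i\<in>D2. emeasure lborel {l i<..<r i})"
            using lr(2) by (subst sum_ennreal[symmetric]) (auto intro!: sum.cong simp: less_imp_le)
          also have "\<dots> = emeasure lborel (\<Union>i\<in>D2. {l i<..<r i})"
            using fin disj by (intro sum_emeasure) (fastforce simp: disjoint_family_on_def)+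
          also have "\<dots> \<le> emeasure lborel U"
            using lr(4) U(1) by (intro emeasure_mono) (force simp: subset_iff)+
          also have "\<dots> < ennreal \<delta>" by fact
          finally show "(\<Sum>i\<in>D2. r i - l i) < \<delta>"
            using lr(2) by (subst (asm) ennreal_less_iff) (auto intro!: sum_nonneg simp: less_imp_le)
        qed (use fin lr disj in \<open>auto simp: less_imp_le\<close>)
        finally show ?thesis .
      qed
      finally have "norm ((\<Sum>(x,k)\<in>D. measure lborel k *\<^sub>R g0 x) - (G b - G a)) < e' * (b - a) + e / 2"
        by simp
      also have "e' * (b - a) \<le> e / 2"
        using ab \<open>e > 0\<close> by (simp add: e'_def field_simps)
      finally show ?thesis by simp
    qed
    ultimately show "\<exists>\<gamma>. gauge \<gamma> \<and> (\<forall>D. D tagged_division_of {a..b} \<and> \<gamma> fine D \<longrightarrow>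
        norm ((\<Sum>(x,k)\<in>D. measure lborel k *\<^sub>R g0 x) - (G b - G a)) < e)"
      by (intro exI[of _ \<gamma>] conjI allI impI) simp_all
  qed
  then show ?thesis
    by (rule has_integral_spike[OF negl, rotated]) (auto simp: g0_def)
qed

section \<open>Square-integrable functions\<close>

lemma L2_I:
  assumes "set_borel_measurable lborel {0<..} g" "set_integrable lborel {0<..} h"
    and "AE x in lborel. x > 0 \<longrightarrow> (cmod (g x))^2 \<le> (h x :: real)"
  shows "L2 g"
  unfolding L2_def
proof
  have "(\<lambda>x. (cmod (indicator {0<..} x *\<^sub>R g x))^2) \<in> borel_measurable lborel"
    using assms(1) unfolding set_borel_measurable_def by measurable
  moreover have "(\<lambda>x. (cmod (indicator {0<..} x *\<^sub>R g x))^2) =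
      (\<lambda>x. indicator {0<..} x *\<^sub>R (cmod (g x))^2)"
    by (auto simp: indicator_def)
  ultimately have "set_borel_measurable lborel {0<..} (\<lambda>x. (cmod (g x))^2)"
    unfolding set_borel_measurable_def by simp
  then show "set_integrable lborel {0<..} (\<lambda>x. (cmod (g x))^2)"
    using assms(2,3) by (auto intro!: set_integrable_bound[of lborel _ h] elim!: eventually_mono)
qed fact

lemma L2_measurable: "L2 f \<Longrightarrow> set_borel_measurable lborel {0<..} f"
  by (simp add: L2_def)

lemma L2_cong_AE:
  assumes "L2 f" "ae_eq f g" "set_borel_measurable lborel {0<..} g"
  shows "L2 g"
proof (rule L2_I[OF assms(3), of "\<lambda>x. (cmod (f x))^2"])
  show "AE x in lborel. x > 0 \<longrightarrow> (cmod (g x))^2 \<le> (cmod (f x))^2"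
    using assms(2) unfolding ae_eq_def by eventually_elim auto
qed (use assms(1) in \<open>simp add: L2_def\<close>)

lemma L2_cmult:
  assumes "L2 f" shows "L2 (\<lambda>x. c * f x)"
proof (rule L2_I)
  have "(\<lambda>x. c * (indicator {0<..} x *\<^sub>R f x)) \<in> borel_measurable lborel"
    using L2_measurable[OF assms] unfolding set_borel_measurable_def
    by (intro borel_measurable_times borel_measurable_const)
  then show "set_borel_measurable lborel {0<..} (\<lambda>x. c * f x)"
    by (simp add: set_borel_measurable_def)
  show "set_integrable lborel {0<..} (\<lambda>x. (cmod c)^2 * (cmod (f x))^2)"
    using assms by (intro set_integrable_mult_right) (simp add: L2_def)
qed (simp add: norm_mult power_mult_distrib)

lemma L2_add:
  assumes "L2 f" "L2 g" shows "L2 (\<lambda>x. f x + g x)"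
proof (rule L2_I)
  have "(\<lambda>x. indicator {0<..} x *\<^sub>R f x + indicator {0<..} x *\<^sub>R g x) \<in> borel_measurable lborel"
    using L2_measurable[OF assms(1)] L2_measurable[OF assms(2)] unfolding set_borel_measurable_def
    by (rule borel_measurable_add)
  then show "set_borel_measurable lborel {0<..} (\<lambda>x. f x + g x)"
    by (simp add: set_borel_measurable_def scaleR_add_right)
  show "set_integrable lborel {0<..} (\<lambda>x. 2 * (cmod (f x))^2 + 2 * (cmod (g x))^2)"
    using assms by (intro set_integral_add set_integrable_mult_right) (auto simp: L2_def)
  have "(cmod (f x + g x))^2 \<le> 2 * (cmod (f x))^2 + 2 * (cmod (g x))^2" for x
  proof -
    have "(cmod (f x + g x))^2 \<le> (cmod (f x) + cmod (g x))^2"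
      by (intro power_mono norm_triangle_ineq) auto
    also have "\<dots> \<le> 2 * (cmod (f x))^2 + 2 * (cmod (g x))^2"
      using sum_squares_bound[of "cmod (f x)" "cmod (g x)"] by (simp add: power2_sum)
    finally show ?thesis .
  qed
  then show "AE x in lborel. 0 < x \<longrightarrow> (cmod (f x + g x))^2 \<le> 2 * (cmod (f x))^2 + 2 * (cmod (g x))^2"
    by simp
qed

lemma L2_zero: "L2 (\<lambda>_. 0)"
  by (simp add: L2_def set_borel_measurable_def set_integrable_def)

lemma L2_sum:
  assumes "\<And>i. i \<in> I \<Longrightarrow> L2 (f i)" shows "L2 (\<lambda>x. \<Sum>i\<in>I. f i x)"
  using assms by (induction I rule: infinite_finite_induct) (auto intro: L2_add L2_zero)

lemma L2_diff:
  assumes "L2 f" "L2 g" shows "L2 (\<lambda>x. f x - g x)"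
  using L2_add[OF assms(1) L2_cmult[OF assms(2), of "-1"]] by simp

lemma continuous_on_set_borel_measurable:
  fixes f :: "real \<Rightarrow> complex"
  assumes "continuous_on {0<..} f" shows "set_borel_measurable lborel {0<..} f"
  using borel_measurable_continuous_on_indicator[OF _ assms]
  by (simp add: set_borel_measurable_def)

text \<open>On a bounded interval |f| <= 1 + |f|^2 suffices. The interval is open so that for
  \<open>a = 0\<close> it avoids the point 0, where \<open>L2\<close> says nothing about
  \<open>f\<close>.\<close>

lemma L2_set_integrable:
  assumes "L2 f" "0 \<le> a" shows "set_integrable lborel {a<..<b} f"
proof -
  have "set_integrable lborel {a<..<b} (\<lambda>x. 1 + (cmod (f x))^2)"
  proof (rule set_integral_add)
    show "set_integrable lborel {a<..<b} (\<lambda>x. (cmod (f x))^2)"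
      using assms by (auto simp: L2_def intro: set_integrable_subset)
    show "set_integrable lborel {a<..<b} (\<lambda>x. 1 :: real)"
      by (cases "a \<le> b") (auto simp: set_integrable_def)
  qed
  moreover have "set_borel_measurable lborel {a<..<b} f"
  proof -
    have "(\<lambda>x. indicator {a<..<b} x *\<^sub>R (indicator {0<..} x *\<^sub>R f x)) \<in> borel_measurable lborel"
      using L2_measurable[OF assms(1)] unfolding set_borel_measurable_def
      by (rule borel_measurable_scaleR[OF borel_measurable_indicator, rotated]) simp
    moreover have "(\<lambda>x. indicator {a<..<b} x *\<^sub>R (indicator {0<..} x *\<^sub>R f x)) =
        (\<lambda>x. indicator {a<..<b} x *\<^sub>R f x)"
      using assms by (auto simp: indicator_def)
    ultimately show ?thesis by (simp add: set_borel_measurable_def)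
  qed
  moreover have "t \<le> \<bar>1 + t\<^sup>2\<bar>" for t :: real
    using zero_le_power2[of "t - 1/2"] by (simp add: power2_eq_square algebra_simps)
  ultimately show ?thesis by (auto intro!: set_integrable_bound[of lborel _ "\<lambda>x. 1 + (cmod (f x))^2"])
qed

lemma L2_integrable_on:
  assumes "L2 f" "0 \<le> a"
  shows "f integrable_on {a..b}" "(\<lambda>x. cmod (f x)) integrable_on {a..b}"
    "(\<lambda>x. (cmod (f x))^2) integrable_on {a..b}"
proof -
  note si = L2_set_integrable[OF assms, of b]
  show "f integrable_on {a..b}"
    using set_borel_integral_eq_integral(1)[OF si] by (simp add: integrable_on_Icc_iff_Ioo)
  show "(\<lambda>x. cmod (f x)) integrable_on {a..b}"
    using set_borel_integral_eq_integral(1)[OF set_integrable_norm[OF si]]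
    by (simp add: integrable_on_Icc_iff_Ioo)
  have "set_integrable lborel {a<..<b} (\<lambda>x. (cmod (f x))^2)"
    using assms by (auto simp: L2_def intro: set_integrable_subset)
  then show "(\<lambda>x. (cmod (f x))^2) integrable_on {a..b}"
    using set_borel_integral_eq_integral(1) by (fastforce simp: integrable_on_Icc_iff_Ioo)
qed

text \<open>Young's inequality |f| <= m/2 |f|^2 + 1/(2m) turns the increments into the L2 mass of
  \<open>f\<close> plus the total length of the intervals, so one choice of \<open>m\<close> works
  for all families. The case \<open>a = 0\<close> is included.\<close>

lemma L2_integral_ac_on:
  assumes f: "L2 f" and a: "0 \<le> a"
  shows "ac_on a b (\<lambda>x. integral {0..x} f)"
  unfolding ac_on_def
proof (intro allI impI)
  fix e :: real assume "e > 0"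
  define K where "K = (LINT x:{0<..}|lborel. (cmod (f x))^2)"
  have sq: "set_integrable lborel {0<..} (\<lambda>x. (cmod (f x))^2)" using f by (simp add: L2_def)
  have "K \<ge> 0" unfolding K_def set_lebesgue_integral_def by (intro Bochner_Integration.integral_nonneg) auto
  \<comment> \<open>This gives \<open>m * K \<le> e\<close>, and with total length below
    \<open>\<delta> = m * e\<close> the two terms of Young's inequality contribute at most e/2
    each.\<close>
  define m where "m = e / (K + 1)"
  have "m > 0" using \<open>e > 0\<close> \<open>K \<ge> 0\<close> by (simp add: m_def)
  have amgm: "t \<le> m / 2 * t\<^sup>2 + 1 / (2 * m)" for t
  proof -
    have "0 \<le> (m * t - 1)\<^sup>2 / (2 * m)" using \<open>m > 0\<close> by simp
    also have "\<dots> = m / 2 * t\<^sup>2 + 1 / (2 * m) - t"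
      using \<open>m > 0\<close> by (simp add: power2_eq_square field_simps)
    finally show ?thesis by simp
  qed
  show "\<exists>\<delta>>0. \<forall>(N::nat) l r.
      (\<forall>i<N. a \<le> l i \<and> l i \<le> r i \<and> r i \<le> b) \<and>
      (\<forall>i<N. \<forall>j<N. i \<noteq> j \<longrightarrow> r i \<le> l j \<or> r j \<le> l i) \<and>
      (\<Sum>i<N. r i - l i) < \<delta> \<longrightarrow>
      (\<Sum>i<N. cmod (integral {0..r i} f - integral {0..l i} f)) < e"
  proof (rule exI[of _ "m * e"], intro conjI allI impI, use \<open>m > 0\<close> \<open>e > 0\<close> in simp, elim conjE)
    fix N :: nat and l r :: "nat \<Rightarrow> real"
    assume lr: "\<forall>i<N. a \<le> l i \<and> l i \<le> r i \<and> r i \<le> b"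
      and disj: "\<forall>i<N. \<forall>j<N. i \<noteq> j \<longrightarrow> r i \<le> l j \<or> r j \<le> l i"
      and len: "(\<Sum>i<N. r i - l i) < m * e"
    have each: "cmod (integral {0..r i} f - integral {0..l i} f) \<le>
        m / 2 * (LINT t:{l i<..<r i}|lborel. (cmod (f t))^2) + (r i - l i) / (2 * m)" if "i < N" for i
    proof -
      have li: "0 \<le> l i" "l i \<le> r i" using lr a that by force+
      note int = L2_integrable_on[OF f li(1), of "r i"]
      have int_m: "(\<lambda>t. m / 2 * (cmod (f t))\<^sup>2) integrable_on {l i..r i}"
        using integrable_cmul[OF int(3), of "m / 2"] by simp
      have "integral {0..l i} f + integral {l i..r i} f = integral {0..r i} f"
        using li L2_integrable_on[OF f order_refl] by (intro Henstock_Kurzweil_Integration.integral_combine) auto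
      then have "cmod (integral {0..r i} f - integral {0..l i} f) = cmod (integral {l i..r i} f)"
        by (metis add_diff_cancel_left')
      also have "\<dots> \<le> integral {l i..r i} (\<lambda>t. m / 2 * (cmod (f t))\<^sup>2 + 1 / (2 * m))"
        by (intro Henstock_Kurzweil_Integration.integral_norm_bound_integral int(1) amgm
            integrable_add int_m integrable_const_ivl)
      also have "\<dots> = integral {l i..r i} (\<lambda>t. m / 2 * (cmod (f t))\<^sup>2) + integral {l i..r i} (\<lambda>t. 1 / (2 * m))"
        by (intro Henstock_Kurzweil_Integration.integral_add int_m integrable_const_ivl)
      also have "\<dots> = m / 2 * integral {l i..r i} (\<lambda>t. (cmod (f t))\<^sup>2) + (r i - l i) / (2 * m)"
        using li by simp
      also have "integral {l i..r i} (\<lambda>t. (cmod (f t))\<^sup>2) = (LINT t:{l i<..<r i}|lborel. (cmod (f t))^2)"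
      proof (subst set_borel_integral_eq_integral(2))
        show "set_integrable lborel {l i<..<r i} (\<lambda>x. (cmod (f x))^2)"
          using li by (intro set_integrable_subset[OF sq]) auto
      qed (simp add: integral_open_interval_real)
      finally show ?thesis .
    qed
    have sub: "(\<Union>i<N. {l i<..<r i}) \<subseteq> {0<..}" using lr a by force
    have "(\<Sum>i<N. LINT t:{l i<..<r i}|lborel. (cmod (f t))^2) =
        (LINT t:(\<Union>i<N. {l i<..<r i})|lborel. (cmod (f t))^2)"
    proof (rule set_integral_finite_Union[symmetric])
      show "disjoint_family_on (\<lambda>i. {l i<..<r i}) {..<N}"
        using disj by (fastforce simp: disjoint_family_on_def)
      show "set_integrable lborel {l i<..<r i} (\<lambda>t. (cmod (f t))\<^sup>2)" if "i \<in> {..<N}" for i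
        using sub that by (intro set_integrable_subset[OF sq]) auto
    qed auto
    also have "\<dots> \<le> K"
      unfolding K_def set_lebesgue_integral_def
    proof (intro integral_mono)
      show "integrable lborel (\<lambda>t. indicat_real (\<Union>i<N. {l i<..<r i}) t *\<^sub>R (cmod (f t))\<^sup>2)"
        using set_integrable_subset[OF sq _ sub] by (simp add: set_integrable_def)
      show "integrable lborel (\<lambda>t. indicat_real {0<..} t *\<^sub>R (cmod (f t))\<^sup>2)"
        using sq by (simp add: set_integrable_def)
      show "indicat_real (\<Union>i<N. {l i<..<r i}) t *\<^sub>R (cmod (f t))\<^sup>2 \<le>
          indicat_real {0<..} t *\<^sub>R (cmod (f t))\<^sup>2" for t
        using subsetD[OF sub, of t] by (intro scaleR_right_mono) (auto split: split_indicator)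
    qed
    finally have S: "(\<Sum>i<N. LINT t:{l i<..<r i}|lborel. (cmod (f t))^2) \<le> K" .
    have "(\<Sum>i<N. cmod (integral {0..r i} f - integral {0..l i} f)) \<le>
        (\<Sum>i<N. m / 2 * (LINT t:{l i<..<r i}|lborel. (cmod (f t))^2) + (r i - l i) / (2 * m))"
      using each by (intro sum_mono) auto
    also have "\<dots> = m / 2 * (\<Sum>i<N. LINT t:{l i<..<r i}|lborel. (cmod (f t))^2)
        + (\<Sum>i<N. r i - l i) / (2 * m)"
      by (simp add: sum.distrib sum_distrib_left sum_divide_distrib)
    also have "\<dots> < m / 2 * K + m * e / (2 * m)"
      using S len \<open>m > 0\<close> by (intro add_le_less_mono mult_left_mono divide_strict_right_mono) auto
    also have "\<dots> = (m * K + e) / 2" using \<open>m > 0\<close> by (simp add: field_simps)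
    also have "m * K \<le> e" using \<open>e > 0\<close> \<open>K \<ge> 0\<close> by (simp add: m_def field_simps)
    then have "(m * K + e) / 2 \<le> e" by simp
    finally show "(\<Sum>i<N. cmod (integral {0..r i} f - integral {0..l i} f)) < e" .
  qed
qed

text \<open>Lebesgue differentiation. \<open>integrable_ccontinuous_explicit\<close> controls
  averages to the right of almost every point; applied to the reflected function
  \<open>\<lambda>x. f (- x)\<close> it controls those to the left.\<close>

lemma AE_has_vector_derivative_integral:
  fixes f :: "real \<Rightarrow> complex"
  assumes f: "\<And>a b. f integrable_on {a..b}"
  shows "AE x in lborel. x > 0 \<longrightarrow> ((\<lambda>u. integral {0..u} f) has_vector_derivative f x) (at x)"
proof -
  obtain N1 where N1: "negligible N1" and d1: "\<And>x e. x \<notin> N1 \<Longrightarrow> 0 < e \<Longrightarrow>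
      \<exists>d>0. \<forall>h. 0 < h \<and> h < d \<longrightarrow> norm (integral {x..x + h} f /\<^sub>R h - f x) < e"
    using integrable_ccontinuous_explicit[of f] f by (auto simp: box_real)
  have f': "(\<lambda>x. f (- x)) integrable_on {a..b}" for a b
    using f[of "-b" "-a"] Henstock_Kurzweil_Integration.integrable_reflect_real[of f "-a" "-b"] by simp
  obtain N2 where N2: "negligible N2" and d2: "\<And>x e. x \<notin> N2 \<Longrightarrow> 0 < e \<Longrightarrow>
      \<exists>d>0. \<forall>h. 0 < h \<and> h < d \<longrightarrow> norm (integral {x..x + h} (\<lambda>x. f (- x)) /\<^sub>R h - f (- x)) < e"
    using integrable_ccontinuous_explicit[of "\<lambda>x. f (- x)"] f' by (auto simp: box_real)
  have "negligible (N1 \<union> uminus ` N2)"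
    using N1 N2 by (intro negligible_Un negligible_differentiable_image_negligible) (auto intro: differentiable_on_minus simp: differentiable_on_ident)
  then have "AE x in lebesgue. x \<notin> N1 \<union> uminus ` N2"
    by (intro AE_not_in) (simp add: negligible_iff_null_sets)
  then have "AE x in lborel. x \<notin> N1 \<union> uminus ` N2" by (simp add: AE_completion_iff)
  then show ?thesis
  proof eventually_elim
    case (elim x)
    then have nx: "x \<notin> N1" "- x \<notin> N2" by (auto simp: image_iff)
    show ?case
    proof
      assume "x > 0"
      show "((\<lambda>u. integral {0..u} f) has_vector_derivative f x) (at x)"
        unfolding has_vector_derivative_def has_derivative_at_alt
      proof (intro conjI allI impI bounded_linear_scaleR_left)
        fix e :: real assume "e > 0"
        obtain \<delta>1 where "\<delta>1 > 0" and \<delta>1: "\<And>h. 0 < h \<Longrightarrow> h < \<delta>1 \<Longrightarrow>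
            norm (integral {x..x + h} f /\<^sub>R h - f x) < e"
          using d1[OF nx(1) \<open>e > 0\<close>] by blast
        obtain \<delta>2 where "\<delta>2 > 0" and \<delta>2: "\<And>h. 0 < h \<Longrightarrow> h < \<delta>2 \<Longrightarrow>
            norm (integral {-x..-x + h} (\<lambda>x. f (- x)) /\<^sub>R h - f x) < e"
          using d2[OF nx(2) \<open>e > 0\<close>] by auto
        \<comment> \<open>Converts closeness of the average over a length \<open>h\<close> into the
          first-order error bound in the definition of the derivative.\<close>
        have scale: "norm (I - h *\<^sub>R c) \<le> e * h" if "norm (I /\<^sub>R h - c) < e" "h > 0" for I c :: complex and h
        proof -
          have "I - h *\<^sub>R c = h *\<^sub>R (I /\<^sub>R h - c)" using that(2) by (simp add: scaleR_diff_right)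
          then have "norm (I - h *\<^sub>R c) = h * norm (I /\<^sub>R h - c)" using that(2) by simp
          then show ?thesis using that by (simp add: mult.commute)
        qed
        \<comment> \<open>The bound by \<open>x\<close> keeps \<open>y\<close> positive, so that
          integrals from 0 can be split at \<open>y\<close> or at \<open>x\<close>.\<close>
        have "norm (integral {0..y} f - integral {0..x} f - (y - x) *\<^sub>R f x) \<le> e * norm (y - x)"
          if y: "norm (y - x) < min x (min \<delta>1 \<delta>2)" for y
        proof (cases y x rule: linorder_cases)
          case greater
          have "integral {0..x} f + integral {x..y} f = integral {0..y} f"
            using greater \<open>x > 0\<close> f by (intro Henstock_Kurzweil_Integration.integral_combine) auto
          then have "integral {0..y} f - integral {0..x} f = integral {x..x + (y - x)} f"
            by (simp add: algebra_simps)
          then show ?thesis using scale[OF \<delta>1[of "y - x"]] greater y by simp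
        next
          case less
          have "integral {0..y} f + integral {y..x} f = integral {0..x} f"
            using less y f by (intro Henstock_Kurzweil_Integration.integral_combine) auto
          moreover have "integral {-x..-x + (x - y)} (\<lambda>x. f (- x)) = integral {y..x} f"
            using Henstock_Kurzweil_Integration.integral_reflect_real[of x y f] by simp
          ultimately have "integral {0..x} f - integral {0..y} f = integral {-x..-x + (x - y)} (\<lambda>x. f (- x))"
            by (simp add: algebra_simps)
          then have "norm (integral {0..x} f - integral {0..y} f - (x - y) *\<^sub>R f x) \<le> e * (x - y)"
            using scale[OF \<delta>2[of "x - y"]] less y by simp
          moreover have "integral {0..y} f - integral {0..x} f - (y - x) *\<^sub>R f x =
              - (integral {0..x} f - integral {0..y} f - (x - y) *\<^sub>R f x)"
            by (simp add: algebra_simps)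
          ultimately show ?thesis using less by (simp only: norm_minus_cancel) simp
        qed simp
        then show "\<exists>d>0. \<forall>y. norm (y - x) < d \<longrightarrow>
            norm (integral {0..y} f - integral {0..x} f - (y - x) *\<^sub>R f x) \<le> e * norm (y - x)"
          using \<open>x > 0\<close> \<open>\<delta>1 > 0\<close> \<open>\<delta>2 > 0\<close> by (intro exI[of _ "min x (min \<delta>1 \<delta>2)"]) auto
      qed
    qed
  qed
qed

text \<open>Extension by 0 to the negative axis makes \<open>f\<close> integrable on every interval
  without changing its integrals from 0.\<close>

lemma L2_AE_has_vector_derivative_integral:
  assumes f: "L2 f"
  shows "AE x in lborel. x > 0 \<longrightarrow> ((\<lambda>u. integral {0..u} f) has_vector_derivative f x) (at x)"
proof -
  define g where "g x = (if x \<in> {0<..} then f x else 0)" for x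
  have g: "g integrable_on {a..b}" for a b
  proof -
    have "f integrable_on {max a 0..b}" by (rule L2_integrable_on[OF f]) simp
    then have "f integrable_on {max a 0<..<b}" by (simp add: integrable_on_Icc_iff_Ioo)
    then have "(\<lambda>x. if x \<in> {max a 0<..<b} then f x else 0) integrable_on UNIV"
      by (simp only: integrable_restrict_UNIV)
    also have "(\<lambda>x. if x \<in> {max a 0<..<b} then f x else 0) = (\<lambda>x. if x \<in> {a<..<b} then g x else 0)"
      by (auto simp: g_def)
    finally show ?thesis by (simp only: integrable_restrict_UNIV integrable_on_Icc_iff_Ioo)
  qed
  have eq: "integral {0..u} g = integral {0..u} f" for u
    by (rule integral_spike[of "{0}"]) (auto simp: g_def)
  show ?thesis
    using AE_has_vector_derivative_integral[OF g] by eventually_elim (simp add: eq g_def)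
qed

text \<open>The everywhere version for continuous \<open>f\<close>, used where a classical
  derivative is required.\<close>

lemma L2_has_vector_derivative_integral:
  assumes f: "L2 f" and x: "x > 0" and cont: "continuous_on {0<..} f"
  shows "((\<lambda>u. integral {0..u} f) has_vector_derivative f x) (at x)"
proof -
  have "((\<lambda>u. integral {0..u} f) has_vector_derivative f x) (at x within ({0..2*x} - {}))"
  proof (rule integral_has_vector_derivative_continuous_at)
    show "f integrable_on {0..2*x}" by (rule L2_integrable_on[OF f order_refl])
    have "isCont f x" using cont x by (simp add: continuous_on_eq_continuous_at)
    then show "continuous (at x within {0..2*x} - {}) f" by (rule continuous_at_imp_continuous_at_within)
  qed (use x in auto)
  then show ?thesis using x by (simp add: at_within_Icc_at)
qed

section \<open>Hardy's inequality and the operators T\<close>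

text \<open>Continuity up to and including 0 is the point: it makes primitives tend to 0 there,
  which later settles all boundary terms.\<close>

lemma continuous_on_integral_from_0:
  fixes f :: "real \<Rightarrow> 'a::banach"
  assumes "\<And>b. f integrable_on {0..b}"
  shows "continuous_on {0..} (\<lambda>x. integral {0..x} f)"
  unfolding continuous_on_eq_continuous_within
proof
  fix x :: real assume x: "x \<in> {0..}"
  have "continuous (at x within {0..x + 1}) (\<lambda>x. integral {0..x} f)"
    using indefinite_integral_continuous_1[OF assms, of "x + 1"] x
    by (auto simp: continuous_on_eq_continuous_within)
  moreover have "at x within {0..x + 1} = at x within {0..}"
    using x by (intro at_within_nhd[of x "{..<x + 1}"]) auto
  ultimately show "continuous (at x within {0..}) (\<lambda>x. integral {0..x} f)" by simp
qed

text \<open>Cauchy--Schwarz with the weight \<open>t powr (1/4)\<close>; integrating against \<open>1/x\<^sup>2\<close> and exchanging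
  the integrals then gives Hardy's inequality with the constant 4.\<close>
lemma integral_norm_sq_le:
  fixes g :: "real \<Rightarrow> complex"
  assumes [measurable]: "g \<in> borel_measurable lborel" and g: "L2 g" and x: "x > 0"
  shows "ennreal ((integral {0..x} (\<lambda>t. cmod (g t)))^2) \<le>
    (\<integral>\<^sup>+t. ennreal (if 0 \<le> t \<and> t \<le> x then t powr (1/2) * (cmod (g t))^2 else 0) \<partial>lborel) * ennreal (2 * x powr (1/2))"
proof -
  have si: "set_integrable lborel {0<..<x} (\<lambda>t. cmod (g t))"
    by (intro set_integrable_norm L2_set_integrable g) simp
  define p where "p t = ennreal (if 0 < t \<and> t < x then t powr (1/4) * cmod (g t) else 0)" for t
  \<comment> \<open>The exponent makes \<open>q\<close> square integrable near 0: the integral of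
    t^(-1/2) over (0,x) is 2 x^(1/2).\<close>
  define q where "q t = ennreal (if 0 < t \<and> t < x then t powr (-1/4) else 0)" for t
  have [measurable]: "p \<in> borel_measurable lborel" "q \<in> borel_measurable lborel"
    unfolding p_def q_def by measurable
  have "ennreal (integral {0..x} (\<lambda>t. cmod (g t))) = ennreal (LINT t:{0<..<x}|lborel. cmod (g t))"
    by (simp add: set_borel_integral_eq_integral(2)[OF si] integral_open_interval_real)
  also have "\<dots> = (\<integral>\<^sup>+t. ennreal (indicator {0<..<x} t *\<^sub>R cmod (g t)) \<partial>lborel)"
    unfolding set_lebesgue_integral_def
    using si by (intro nn_integral_eq_integral[symmetric]) (auto simp: set_integrable_def)
  also have "\<dots> = (\<integral>\<^sup>+t. p t * q t \<partial>lborel)"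
  proof (intro nn_integral_cong)
    fix t :: real
    have "t powr (1/4) * t powr (-1/4) = 1" if "t > 0"
      using that by (simp flip: powr_add)
    then show "ennreal (indicator {0<..<x} t *\<^sub>R cmod (g t)) = p t * q t"
      by (auto simp: p_def q_def ennreal_mult[symmetric] mult_ac)
  qed
  finally have "ennreal ((integral {0..x} (\<lambda>t. cmod (g t)))^2) = (\<integral>\<^sup>+t. p t * q t \<partial>lborel)^2"
    by (metis ennreal_power integral_nonneg L2_integrable_on(2)[OF g order_refl] norm_ge_zero)
  also have "\<dots> \<le> (\<integral>\<^sup>+t. (p t)^2 \<partial>lborel) * (\<integral>\<^sup>+t. (q t)^2 \<partial>lborel)"
    by (rule Cauchy_Schwarz_nn_integral) measurable
  also have "\<dots> \<le> (\<integral>\<^sup>+t. ennreal (if 0 \<le> t \<and> t \<le> x then t powr (1/2) * (cmod (g t))^2 else 0) \<partial>lborel) *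
      ennreal (2 * x powr (1/2))"
  proof (rule mult_mono)
    show "(\<integral>\<^sup>+t. (p t)^2 \<partial>lborel) \<le>
      (\<integral>\<^sup>+t. ennreal (if 0 \<le> t \<and> t \<le> x then t powr (1/2) * (cmod (g t))^2 else 0) \<partial>lborel)"
    by (intro nn_integral_mono)
      (auto simp: p_def ennreal_power power_mult_distrib powr_power)
    have "(\<integral>\<^sup>+t. (q t)^2 \<partial>lborel) \<le> (\<integral>\<^sup>+t. ennreal (indicator {0..x} t * t powr (-1/2)) \<partial>lborel)"
    by (intro nn_integral_mono)
      (auto simp: q_def ennreal_power powr_power)
  also have "\<dots> = ennreal (2 * x powr (1/2))"
    using has_integral_powr_from_0[of "-1/2" x] x
    by (subst nn_integral_has_integral_lebesgue[where I = "x powr (1/2) / (1/2)"]) auto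
    finally show "(\<integral>\<^sup>+t. (q t)^2 \<partial>lborel) \<le> ennreal (2 * x powr (1/2))" .
  qed auto
  finally show ?thesis .
qed

theorem hardy_inequality:
  assumes f: "L2 f"
  shows "set_integrable lborel {0<..} (\<lambda>x. (integral {0..x} (\<lambda>t. cmod (f t)) / x)^2)"
proof -
  \<comment> \<open>The cut-off function is Borel measurable on the whole line, which makes the
    kernel below jointly measurable for Tonelli.\<close>
  define g where "g t = indicator {0<..} t *\<^sub>R f t" for t
  have gm [measurable]: "g \<in> borel_measurable lborel"
    using L2_measurable[OF f] by (simp add: set_borel_measurable_def g_def[abs_def])
  have g: "L2 g"
  proof (rule L2_cong_AE[OF f])
    have "(\<lambda>x. indicator {0<..} x *\<^sub>R g x) = g"
      by (rule ext) (simp add: g_def indicator_def)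
    then show "set_borel_measurable lborel {0<..} g" using gm by (simp add: set_borel_measurable_def)
  qed (simp add: ae_eq_def g_def)
  have Phi_eq: "integral {0..x} (\<lambda>t. cmod (f t)) = integral {0..x} (\<lambda>t. cmod (g t))" for x
    by (rule integral_spike[of "{0}"]) (auto simp: g_def)
  define Phi where "Phi x = integral {0..x} (\<lambda>t. cmod (g t))" for x
  have "continuous_on {0..} Phi"
    unfolding Phi_def by (intro continuous_on_integral_from_0 L2_integrable_on g) simp
  then have "continuous_on {0<..} (\<lambda>x. (Phi x / x)^2)"
    by (intro continuous_intros) (auto elim: continuous_on_subset)
  then have meas: "(\<lambda>x. indicator {0<..} x *\<^sub>R (Phi x / x)^2) \<in> borel_measurable lborel"
    using borel_measurable_continuous_on_indicator[of "{0<..}" "\<lambda>x. (Phi x / x)^2"] by simp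
  \<comment> \<open>The factor 2 x^(-3/2) is the product of 1/x^2 and the 2 x^(1/2) produced by
    Cauchy-Schwarz.\<close>
  define k where "k x t = ennreal (if 0 < x \<and> 0 < t \<and> t \<le> x
      then (2 * x powr (-3/2)) * (t powr (1/2) * (cmod (g t))^2) else 0)" for x t :: real
  have km: "case_prod k \<in> borel_measurable (lborel \<Otimes>\<^sub>M lborel)"
    unfolding k_def by measurable
  have "(\<integral>\<^sup>+x. ennreal (norm (indicator {0<..} x *\<^sub>R (Phi x / x)^2)) \<partial>lborel) \<le>
      (\<integral>\<^sup>+x. (\<integral>\<^sup>+t. k x t \<partial>lborel) \<partial>lborel)"
  proof (intro nn_integral_mono)
    fix x :: real
    show "ennreal (norm (indicator {0<..} x *\<^sub>R (Phi x / x)^2)) \<le> (\<integral>\<^sup>+t. k x t \<partial>lborel)"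
    proof (cases "x > 0")
      case True
      let ?I = "\<integral>\<^sup>+t. ennreal (if 0 \<le> t \<and> t \<le> x then t powr (1/2) * (cmod (g t))^2 else 0) \<partial>lborel"
      have "ennreal (norm (indicator {0<..} x *\<^sub>R (Phi x / x)^2)) =
          ennreal (1 / x^2) * ennreal ((integral {0..x} (\<lambda>t. cmod (g t)))^2)"
        using True by (simp add: Phi_def power_divide flip: ennreal_mult)
      also have "\<dots> \<le> ennreal (1 / x^2) * (?I * ennreal (2 * x powr (1/2)))"
        by (intro mult_left_mono integral_norm_sq_le gm g True) simp
      also have "\<dots> = ennreal (1 / x^2) * ennreal (2 * x powr (1/2)) * ?I"
        by (simp add: mult_ac)
      also have "ennreal (1 / x^2) * ennreal (2 * x powr (1/2)) = ennreal (2 * (x powr (1/2) / x powr 2))"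
        using True by (simp add: powr_realpow flip: ennreal_mult)
      also have "x powr (1/2) / x powr 2 = x powr (-3/2)"
        by (simp flip: powr_diff)
      also have "ennreal (2 * x powr (-3/2)) * ?I = (\<integral>\<^sup>+t. ennreal (2 * x powr (-3/2)) *
          ennreal (if 0 \<le> t \<and> t \<le> x then t powr (1/2) * (cmod (g t))^2 else 0) \<partial>lborel)"
        by (rule nn_integral_cmult[symmetric]) measurable
      also have "\<dots> = (\<integral>\<^sup>+t. k x t \<partial>lborel)"
        using True by (intro nn_integral_cong) (auto simp: k_def ennreal_mult)
      finally show ?thesis .
    qed simp
  qed
  also have "\<dots> = (\<integral>\<^sup>+t. (\<integral>\<^sup>+x. k x t \<partial>lborel) \<partial>lborel)"
    using lborel_pair.Fubini'[OF km] by simp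
  \<comment> \<open>Integrating 2 x^(-3/2) over x >= t gives 4 t^(-1/2), and the weight t^(1/2)
    cancels exactly.\<close>
  also have "\<dots> = (\<integral>\<^sup>+t. ennreal (4 * (norm (indicator {0<..} t *\<^sub>R (cmod (f t))^2))) \<partial>lborel)"
  proof (intro nn_integral_cong)
    fix t :: real
    show "(\<integral>\<^sup>+x. k x t \<partial>lborel) = ennreal (4 * (norm (indicator {0<..} t *\<^sub>R (cmod (f t))^2)))"
    proof (cases "t > 0")
      case True
      have "(\<integral>\<^sup>+x. k x t \<partial>lborel) = (\<integral>\<^sup>+x. ennreal (2 * (t powr (1/2) * (cmod (g t))^2)) *
          ennreal (indicator {t..} x * x powr (-3/2)) \<partial>lborel)"
        using True by (intro nn_integral_cong) (auto simp: k_def mult_ac simp flip: ennreal_mult)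
      also have "\<dots> = ennreal (2 * (t powr (1/2) * (cmod (g t))^2)) *
          (\<integral>\<^sup>+x. ennreal (indicator {t..} x * x powr (-3/2)) \<partial>lborel)"
        by (rule nn_integral_cmult) measurable
      also have "(\<integral>\<^sup>+x. ennreal (indicator {t..} x * x powr (-3/2)) \<partial>lborel) = ennreal (2 * t powr (-1/2))"
        using has_integral_powr_to_inf[of "-3/2" t] True
        by (subst nn_integral_has_integral_lebesgue[where I = "2 * t powr (-1/2)"]) (auto simp: mult.commute)
      also have "ennreal (2 * (t powr (1/2) * (cmod (g t))^2)) * ennreal (2 * t powr (-1/2)) =
          ennreal (4 * (t powr (1/2) * t powr (-1/2)) * (cmod (g t))^2)"
        by (subst ennreal_mult[symmetric]) (simp_all add: mult_ac)
      also have "t powr (1/2) * t powr (-1/2) = 1" using True by (simp flip: powr_add)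
      finally show ?thesis using True by (simp add: g_def)
    qed (simp add: k_def)
  qed
  also have "\<dots> < \<infinity>"
  proof -
    have "integrable lborel (\<lambda>t. 4 * (indicator {0<..} t *\<^sub>R (cmod (f t))^2))"
      using f by (auto simp: L2_def set_integrable_def)
    from iffD1[OF integrable_iff_bounded this] show ?thesis by (simp add: abs_mult)
  qed
  finally show ?thesis
    unfolding set_integrable_def integrable_iff_bounded Phi_eq Phi_def[symmetric]
    by (intro conjI meas)
qed

text \<open>Bounding each integrand by its majorant at the upper limit costs one factor x per
  integration. After division by x^(m+1) only the average of |f| is left, whatever m is. Continuity
  is carried along because it makes the next iterate integrable.\<close>

lemma iint_continuous_bound:
  assumes f: "L2 f"
  shows "continuous_on {0..} (iint (Suc m) f) \<and>
    (\<forall>x\<ge>0. cmod (iint (Suc m) f x) \<le> x^m * integral {0..x} (\<lambda>t. cmod (f t)))"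
proof (induction m)
  case 0
  show ?case
    using L2_integrable_on[OF f order_refl]
    by (auto intro!: continuous_on_integral_from_0 Henstock_Kurzweil_Integration.integral_norm_bound_integral)
next
  case (Suc m)
  have int: "iint (Suc m) f integrable_on {0..b}" for b
    using Suc by (intro integrable_continuous_interval) (auto elim: continuous_on_subset)
  have "cmod (iint (Suc (Suc m)) f x) \<le> x^Suc m * integral {0..x} (\<lambda>t. cmod (f t))" if "x \<ge> 0" for x
  proof -
    have "cmod (iint (Suc m) f t) \<le> x^m * integral {0..x} (\<lambda>t. cmod (f t))" if t: "t \<in> {0..x}" for t
    proof -
      have "cmod (iint (Suc m) f t) \<le> t^m * integral {0..t} (\<lambda>t. cmod (f t))"
        using Suc t by simp
      also have "\<dots> \<le> x^m * integral {0..x} (\<lambda>t. cmod (f t))"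
        using t L2_integrable_on[OF f order_refl]
        by (intro mult_mono power_mono integral_subset_le Henstock_Kurzweil_Integration.integral_nonneg) auto
      finally show ?thesis .
    qed
    then have "cmod (integral {0..x} (iint (Suc m) f)) \<le>
        integral {0..x} (\<lambda>_. x^m * integral {0..x} (\<lambda>t. cmod (f t)))"
      by (intro Henstock_Kurzweil_Integration.integral_norm_bound_integral int integrable_const_ivl) auto
    then show ?thesis using \<open>x \<ge> 0\<close> by (simp add: mult_ac)
  qed
  moreover have "continuous_on {0..} (iint (Suc (Suc m)) f)"
    using continuous_on_integral_from_0[OF int] by simp
  ultimately show ?case by blast
qed

lemma iint_has_vector_derivative:
  assumes f: "L2 f" and x: "x > 0" and m: "m \<ge> 1"
  shows "(iint (Suc m) f has_vector_derivative iint m f x) (at x)"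
proof -
  obtain m' where m': "m = Suc m'" using m by (cases m) auto
  have cont: "continuous_on {0..} (iint m f)" using iint_continuous_bound[OF f] by (simp only: m')
  have "((\<lambda>u. integral {0..u} (iint m f)) has_vector_derivative iint m f x) (at x within {0..2*x})"
    using cont x by (intro integral_has_vector_derivative) (auto elim: continuous_on_subset)
  then show ?thesis using x by (simp add: at_within_Icc_at)
qed

lemma T_continuous_on:
  assumes "L2 f" shows "continuous_on {0<..} (T (Suc m) f)"
proof -
  have "continuous_on {0<..} (iint (Suc m) f)"
    by (rule continuous_on_subset[OF conjunct1[OF iint_continuous_bound[OF assms]]]) auto
  then show ?thesis
    unfolding T_def
    by (intro continuous_on_divide continuous_on_power continuous_on_of_real continuous_on_id) auto
qed

lemma T_0: "T 0 f = f" by (simp add: T_def)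

lemma T_L2:
  assumes f: "L2 f" shows "L2 (T m f)"
proof (cases m)
  case (Suc k)
  show ?thesis
  proof (rule L2_I)
    show "set_borel_measurable lborel {0<..} (T m f)"
      unfolding Suc by (intro continuous_on_set_borel_measurable T_continuous_on f)
    show "set_integrable lborel {0<..} (\<lambda>x. (integral {0..x} (\<lambda>t. cmod (f t)) / x)^2)"
      by (rule hardy_inequality[OF f])
    have "cmod (T m f x) \<le> integral {0..x} (\<lambda>t. cmod (f t)) / x" if "x > 0" for x
    proof -
      have "cmod (T m f x) = cmod (iint (Suc k) f x) / x ^ Suc k"
        using that by (simp only: T_def Suc norm_divide norm_power norm_of_real abs_of_pos)
      also have "\<dots> \<le> (x^k * integral {0..x} (\<lambda>t. cmod (f t))) / x ^ Suc k"
        using iint_continuous_bound[OF f, of k] that by (intro divide_right_mono) auto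
      also have "\<dots> = integral {0..x} (\<lambda>t. cmod (f t)) / x" using that by simp
      finally show ?thesis .
    qed
    then show "AE x in lborel. 0 < x \<longrightarrow>
        (cmod (T m f x))\<^sup>2 \<le> (integral {0..x} (\<lambda>t. cmod (f t)) / x)\<^sup>2"
      by (intro AE_I2 impI power_mono) auto
  qed
qed (simp add: T_0 f)

text \<open>For m >= 1 the integrand is the derivative of x T_{m+1} f, by the product rule applied
  to the iterated integral and x^(-m). The fundamental theorem then needs continuity of that
  function only at the left endpoint.\<close>

lemma T_has_integral_step:
  assumes f: "L2 f" and x: "x > 0"
  shows "integral {0..x} (\<lambda>t. T m f t - of_nat m * T (Suc m) f t) = of_real x * T (Suc m) f x"
proof (cases "m = 0")
  case True
  then show ?thesis using x by (simp add: T_def)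
next
  case False
  let ?Phi = "\<lambda>x. integral {0..x} (\<lambda>t. cmod (f t))"
  \<comment> \<open>For t > 0 this is t times \<open>T (Suc m) f t\<close>.\<close>
  define G where "G t = iint (Suc m) f t / of_real t ^ m" for t
  have F: "continuous_on {0..} (iint (Suc m) f)"
    "\<And>x. x \<ge> 0 \<Longrightarrow> cmod (iint (Suc m) f x) \<le> x^m * ?Phi x"
    using iint_continuous_bound[OF f, of m] by auto
  have contPhi: "continuous_on {0..} ?Phi"
    by (intro continuous_on_integral_from_0 L2_integrable_on f) simp
  have GPhi: "cmod (G t) \<le> ?Phi t" if "t \<ge> 0" for t
  proof (cases "t = 0")
    case False
    have "cmod (G t) = cmod (iint (Suc m) f t) / t^m"
      using that by (simp only: G_def norm_divide norm_power norm_of_real abs_of_nonneg)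
    then show ?thesis using F(2)[OF that] that False by (simp add: divide_le_eq mult_ac)
  qed (use \<open>m \<noteq> 0\<close> in \<open>simp add: G_def\<close>)
  \<comment> \<open>At t = 0 the bound by \<open>?Phi\<close>, which tends to 0, gives the limit;
    \<open>G 0 = 0\<close> because m > 0 makes the denominator 0 and division by 0 yields 0.\<close>
  have "continuous (at t within {0..}) G" if "t \<ge> 0" for t
  proof (cases "t = 0")
    case True
    have "(?Phi \<longlongrightarrow> ?Phi 0) (at 0 within {0..})"
      using bspec[OF contPhi[unfolded continuous_on], of 0] by (simp only: atLeast_iff order_refl simp_thms)
    then have "(?Phi \<longlongrightarrow> 0) (at 0 within {0..})" by simp
    then have "(G \<longlongrightarrow> 0) (at 0 within {0..})"
      by (rule Lim_null_comparison[rotated]) (auto simp: eventually_at_filter GPhi)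
    then show ?thesis using True \<open>m \<noteq> 0\<close> by (simp add: continuous_within G_def)
  next
    case False
    then have "isCont (iint (Suc m) f) t"
      using F(1) that by (intro continuous_on_interior[of "{0..}"]) auto
    then have "isCont G t" unfolding G_def using False by (intro continuous_intros) auto
    then show ?thesis by (rule continuous_at_imp_continuous_at_within)
  qed
  then have "continuous_on {0..} G" by (simp add: continuous_on_eq_continuous_within)
  then have contG: "continuous_on {0..x} G" by (rule continuous_on_subset) auto
  have "(G has_vector_derivative (T m f t - of_nat m * T (Suc m) f t)) (at t)" if "t > 0" for t
  proof -
    have d1: "(iint (Suc m) f has_vector_derivative iint m f t) (at t)"
      using False that by (intro iint_has_vector_derivative f) auto
    have d2: "((\<lambda>t. 1 / complex_of_real t ^ m) has_vector_derivative
        (- (of_nat m / of_real t ^ Suc m))) (at t)"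
    proof -
      obtain k where k: "m = Suc k" using False by (cases m) auto
      have "((\<lambda>z. 1 / z ^ m) has_field_derivative
          (0 * of_real t ^ m - 1 * (of_nat m * of_real t ^ (m - 1))) / (of_real t ^ m * of_real t ^ m))
          (at (complex_of_real t))"
        using that DERIV_power[OF DERIV_ident, of m "complex_of_real t" UNIV]
        by (intro DERIV_divide DERIV_const) auto
      also have "(0 * complex_of_real t ^ m - 1 * (of_nat m * of_real t ^ (m - 1))) / (of_real t ^ m * of_real t ^ m) =
          - (of_nat m / of_real t ^ Suc m)"
        using that by (simp add: k field_simps)
      finally show ?thesis by (rule has_vector_derivative_real_field)
    qed
    have "((\<lambda>t. iint (Suc m) f t * (1 / complex_of_real t ^ m)) has_vector_derivative
       (iint (Suc m) f t * (- (of_nat m / of_real t ^ Suc m)) + iint m f t * (1 / complex_of_real t ^ m))) (at t)"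
      by (rule has_vector_derivative_mult[OF d1 d2])
    then show ?thesis by (simp add: G_def[abs_def] T_def mult_ac)
  qed
  then have "((\<lambda>t. T m f t - of_nat m * T (Suc m) f t) has_integral G x - G 0) {0..x}"
    using x contG by (intro fundamental_theorem_of_calculus_interior) auto
  then show ?thesis
    using x \<open>m \<noteq> 0\<close> by (simp add: integral_unique G_def T_def)
qed

section \<open>The inverse of the averaging operator\<close>

text \<open>Otherwise the simplifier turns \<open>Tinv 1\<close> into \<open>Tinv (Suc 0)\<close>.\<close>
declare One_nat_def [simp del]

section \<open>Almost everywhere equality on the half-line\<close>

lemma ae_eq_refl: "ae_eq f f" by (simp add: ae_eq_def)

lemma ae_eq_sym: "ae_eq f g \<Longrightarrow> ae_eq g f"
  unfolding ae_eq_def by (auto elim: eventually_mono)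

lemma ae_eq_trans: "ae_eq f g \<Longrightarrow> ae_eq g h \<Longrightarrow> ae_eq f h"
  unfolding ae_eq_def by (elim eventually_elim2) auto

lemma ae_eq_add: "ae_eq f f' \<Longrightarrow> ae_eq g g' \<Longrightarrow> ae_eq (\<lambda>x. f x + g x) (\<lambda>x. f' x + g' x)"
  unfolding ae_eq_def by (elim eventually_elim2) auto

lemma ae_eq_diff: "ae_eq f f' \<Longrightarrow> ae_eq g g' \<Longrightarrow> ae_eq (\<lambda>x. f x - g x) (\<lambda>x. f' x - g' x)"
  unfolding ae_eq_def by (elim eventually_elim2) auto

lemma ae_eq_cmult: "ae_eq f f' \<Longrightarrow> ae_eq (\<lambda>x. c * f x) (\<lambda>x. c * f' x)"
  unfolding ae_eq_def by (auto elim: eventually_mono)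

lemma ae_eq_sum:
  assumes "\<And>i. i \<in> I \<Longrightarrow> ae_eq (f i) (g i)"
  shows "ae_eq (\<lambda>x. \<Sum>i\<in>I. f i x) (\<lambda>x. \<Sum>i\<in>I. g i x)"
  using assms by (induction I rule: infinite_finite_induct) (auto intro: ae_eq_add ae_eq_refl)

lemma ae_eq_imp_negligible:
  assumes "ae_eq f g" shows "negligible {t. t > 0 \<and> f t \<noteq> g t}"
proof -
  obtain N where "{t \<in> space lborel. \<not> (t \<in> {0<..} \<longrightarrow> f t = g t)} \<subseteq> N"
      "emeasure lborel N = 0" "N \<in> sets lborel"
    using assms unfolding ae_eq_def by (rule AE_E)
  then have "negligible N" "{t. t > 0 \<and> f t \<noteq> g t} \<subseteq> N"
    by (auto simp: negligible_iff_null_sets intro!: null_sets_completionI null_setsI)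
  then show ?thesis by (rule negligible_subset)
qed

lemma ae_eq_imp_integral_eq:
  assumes "ae_eq f g" shows "integral {0..x} f = integral {0..x} g"
  \<comment> \<open>The point 0 is adjoined to the null set, since \<open>ae_eq\<close> does not
    constrain it.\<close>
  by (rule integral_spike[OF negligible_insert[THEN iffD2, OF ae_eq_imp_negligible[OF assms], of 0]]) auto

text \<open>The set where two continuous functions differ is open, and a nonempty open set is not
  negligible.\<close>

lemma ae_eq_continuous_imp_eq:
  assumes "ae_eq f g" "continuous_on {0<..} f" "continuous_on {0<..} g" "x > 0"
  shows "f x = g x"
proof (rule ccontr)
  assume "f x \<noteq> g x"
  define S where "S = {0<..} \<inter> (\<lambda>x. f x - g x) -` (- {0})"
  have "open S" unfolding S_def
    by (intro continuous_open_preimage continuous_intros assms)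
  moreover have "x \<in> S" using \<open>f x \<noteq> g x\<close> assms(4) by (simp add: S_def)
  ultimately have "\<not> negligible S" using open_not_negligible by blast
  moreover have "S = {t. t > 0 \<and> f t \<noteq> g t}" by (auto simp: S_def)
  with ae_eq_imp_negligible[OF assms(1)] have "negligible S" by simp
  ultimately show False by blast
qed

lemma L2_integral_continuous_on:
  assumes "L2 f" shows "continuous_on {0..} (\<lambda>x. integral {0..x} f)"
  by (intro continuous_on_integral_from_0 L2_integrable_on assms) simp

text \<open>Clearing the denominator gives a condition linear in \<open>g\<close> and
  \<open>h\<close>, from which congruence and linearity of the graph follow.\<close>

lemma Tinv_1_iff:
  "Tinv 1 g h \<longleftrightarrow> L2 g \<and> L2 h \<and> (AE x in lborel. x > 0 \<longrightarrow> integral {0..x} h = of_real x * g x)"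
proof -
  have "ae_eq (T 1 h) g \<longleftrightarrow> (AE x in lborel. x > 0 \<longrightarrow> integral {0..x} h = of_real x * g x)"
    unfolding ae_eq_def by (intro AE_cong) (auto simp: T_def One_nat_def field_simps)
  then show ?thesis by (simp add: Tinv_def)
qed

lemma Tinv_L2: "Tinv m g h \<Longrightarrow> L2 g" "Tinv m g h \<Longrightarrow> L2 h"
  by (simp_all add: Tinv_def)

lemma Tinv_1_cong:
  assumes "Tinv 1 g h" "ae_eq g g'" "L2 g'" "ae_eq h h'" "L2 h'"
  shows "Tinv 1 g' h'"
proof -
  have "AE x in lborel. x > 0 \<longrightarrow> integral {0..x} h = of_real x * g x"
    using assms(1) by (simp add: Tinv_1_iff)
  then have "AE x in lborel. x > 0 \<longrightarrow> integral {0..x} h' = of_real x * g' x"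
    using assms(2) unfolding ae_eq_def
    by eventually_elim (use ae_eq_imp_integral_eq[OF assms(4)] in auto)
  then show ?thesis using assms by (simp add: Tinv_1_iff)
qed

lemma Tinv_1_add:
  assumes "Tinv 1 g h" "Tinv 1 g' h'"
  shows "Tinv 1 (\<lambda>x. g x + g' x) (\<lambda>x. h x + h' x)"
proof -
  have L: "L2 h" "L2 h'" using assms by (simp_all add: Tinv_1_iff)
  have "integral {0..x} (\<lambda>t. h t + h' t) = integral {0..x} h + integral {0..x} h'" for x
    by (intro Henstock_Kurzweil_Integration.integral_add L2_integrable_on L) auto
  moreover have "AE x in lborel. x > 0 \<longrightarrow> integral {0..x} h + integral {0..x} h' = of_real x * (g x + g' x)"
    using assms unfolding Tinv_1_iff by (auto elim!: eventually_elim2 simp: algebra_simps)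
  ultimately show ?thesis using assms by (simp add: Tinv_1_iff L2_add)
qed

lemma Tinv_1_cmult:
  assumes "Tinv 1 g h" shows "Tinv 1 (\<lambda>x. c * g x) (\<lambda>x. c * h x)"
proof -
  have "AE x in lborel. x > 0 \<longrightarrow> c * integral {0..x} h = of_real x * (c * g x)"
    using assms unfolding Tinv_1_iff by (auto elim!: eventually_mono simp: algebra_simps)
  then show ?thesis using assms by (simp add: Tinv_1_iff L2_cmult)
qed

lemma Tinv_1_diff:
  assumes "Tinv 1 g h" "Tinv 1 g' h'"
  shows "Tinv 1 (\<lambda>x. g x - g' x) (\<lambda>x. h x - h' x)"
  using Tinv_1_add[OF assms(1) Tinv_1_cmult[OF assms(2), of "-1"]] by simp

lemma Tinv_1_zero: "Tinv 1 (\<lambda>_. 0) (\<lambda>_. 0)"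
  by (simp add: Tinv_1_iff L2_zero)

lemma Tinv_1_sum:
  assumes "\<And>i. i \<in> I \<Longrightarrow> Tinv 1 (g i) (h i)"
  shows "Tinv 1 (\<lambda>x. \<Sum>i\<in>I. g i x) (\<lambda>x. \<Sum>i\<in>I. h i x)"
  using assms by (induction I rule: infinite_finite_induct) (auto intro: Tinv_1_add Tinv_1_zero)

text \<open>Injectivity of T_1. By linearity the difference has a primitive that vanishes a.e.,
  hence everywhere by continuity; Lebesgue differentiation then returns 0.\<close>

lemma Tinv_1_functional:
  assumes "Tinv 1 g h" "Tinv 1 g h'" shows "ae_eq h h'"
proof -
  define w where "w x = h x - h' x" for x
  have w: "Tinv 1 (\<lambda>_. 0) w" using Tinv_1_diff[OF assms] by (simp add: w_def[abs_def])
  then have L: "L2 w" by (simp add: Tinv_1_iff)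
  have "ae_eq (\<lambda>x. integral {0..x} w) (\<lambda>_. 0)"
    using w by (simp add: Tinv_1_iff ae_eq_def)
  then have 0: "integral {0..x} w = 0" if "x > 0" for x
    by (rule ae_eq_continuous_imp_eq[OF _ continuous_on_subset[OF L2_integral_continuous_on[OF L]]])
      (use that in auto)
  have "AE x in lborel. x > 0 \<longrightarrow> w x = 0"
    using L2_AE_has_vector_derivative_integral[OF L]
  proof eventually_elim
    case (elim x)
    show ?case
    proof
      assume x: "x > 0"
      have "((\<lambda>u. integral {0..u} w) has_vector_derivative w x) (at x)" using elim x by simp
      moreover have "eventually (\<lambda>u. u \<in> {0<..}) (nhds x)"
        using x by (intro eventually_nhds_in_open) auto
      then have "eventually (\<lambda>u. integral {0..u} w = 0) (nhds x)"
        by eventually_elim (simp add: 0)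
      ultimately have "((\<lambda>u. 0) has_vector_derivative w x) (at x)"
        by (subst (asm) has_vector_derivative_cong_ev[where g = "\<lambda>_. 0"]) (auto simp: 0 x elim: eventually_mono)
      then show "w x = 0"
        using vector_derivative_unique_at has_vector_derivative_const by blast
    qed
  qed
  then show ?thesis unfolding ae_eq_def by eventually_elim (auto simp: w_def)
qed

text \<open>A solution of \<open>(x w)' = - m w\<close> is a multiple of \<open>x powr (-m - 1)\<close>; its primitive must vanish at 0.\<close>
lemma Tinv_1_eigen:
  assumes w: "Tinv 1 w (\<lambda>x. - of_nat m * w x)" shows "ae_eq w (\<lambda>_. 0)"
proof -
  have L: "L2 w" using w by (simp add: Tinv_1_iff)
  define W where "W x = integral {0..x} w" for x
  have W: "AE x in lborel. x > 0 \<longrightarrow> - of_nat m * W x = of_real x * w x"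
    using w by (simp add: Tinv_1_iff W_def)
  have contW: "continuous_on {0..} W" unfolding W_def by (rule L2_integral_continuous_on[OF L])
  then have contW': "continuous_on {0<..} W" by (rule continuous_on_subset) auto
  \<comment> \<open>A continuous representative of \<open>w\<close>, so that its primitive
    \<open>W\<close> is differentiable at every point and not only a.e.\<close>
  define v where "v x = - of_nat m * W x / of_real x" for x
  have wv: "ae_eq w v" unfolding ae_eq_def using W by eventually_elim (auto simp: v_def field_simps)
  have contv: "continuous_on {0<..} v"
    unfolding v_def by (intro continuous_intros contW') auto
  have Lv: "L2 v" by (rule L2_cong_AE[OF L wv continuous_on_set_borel_measurable[OF contv]])
  have Wv: "W x = integral {0..x} v" for x
    unfolding W_def by (rule ae_eq_imp_integral_eq[OF wv])
  have "W x = 0" if x: "x > 0" and m: "m > 0" for x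
  proof -
    \<comment> \<open>Integrating factor for t W' = - m W. Since m > 0, the constant t^m W vanishes
      at 0.\<close>
    have "((\<lambda>t. of_real t ^ m * W t) has_vector_derivative 0) (at t)" if t: "t \<in> {0<..<x}" for t
    proof -
      have d1: "(W has_vector_derivative v t) (at t)"
        using L2_has_vector_derivative_integral[OF Lv _ contv, of t] t by (simp add: Wv[abs_def])
      have d2: "((\<lambda>t. complex_of_real t ^ m) has_vector_derivative of_nat m * of_real t ^ (m - 1)) (at t)"
        using DERIV_power[OF DERIV_ident, of m "complex_of_real t" UNIV]
        by (intro has_vector_derivative_real_field) (simp add: One_nat_def)
      have "((\<lambda>t. of_real t ^ m * W t) has_vector_derivative
          (of_real t ^ m * v t + of_nat m * of_real t ^ (m - 1) * W t)) (at t)"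
        by (rule has_vector_derivative_mult[OF d2 d1])
      also have "of_real t ^ m * v t + of_nat m * of_real t ^ (m - 1) * W t = 0"
        using m t by (cases m) (auto simp: v_def field_simps)
      finally show ?thesis .
    qed
    moreover have "continuous_on {0..x} (\<lambda>t. of_real t ^ m * W t)"
      by (intro continuous_intros continuous_on_subset[OF contW]) auto
    ultimately have "((\<lambda>t. 0) has_integral (of_real x ^ m * W x - of_real 0 ^ m * W 0)) {0..x}"
      using x by (intro fundamental_theorem_of_calculus_interior[where f = "\<lambda>t. of_real t ^ m * W t"]) auto
    then have "of_real x ^ m * W x - of_real 0 ^ m * W 0 = 0"
      by (rule has_integral_unique) (rule has_integral_0)
    then show ?thesis using m x by (simp add: power_0_left)
  qed
  then show ?thesis
    \<comment> \<open>For m = 0 the equation itself reads x w = 0.\<close>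
    unfolding ae_eq_def using W by (cases "m = 0") (auto elim!: eventually_mono)
qed

text \<open>This is (A + m) T_{m+1} h = T_m h with m T_{m+1} h moved to the right, so that only the
  graph of A occurs.\<close>

lemma Tinv_1_T:
  assumes h: "L2 h"
  shows "Tinv 1 (T (Suc m) h) (\<lambda>x. T m h x - of_nat m * T (Suc m) h x)"
  unfolding Tinv_1_iff
  using T_L2[OF h] T_has_integral_step[OF h, of _ m] by (auto intro!: L2_diff L2_cmult)

section \<open>Powers of the inverse\<close>

lemma opow_L2: "opow (Tinv 1) k g h \<Longrightarrow> L2 g" "opow (Tinv 1) k g h \<Longrightarrow> L2 h"
  by (induction k arbitrary: g) (auto dest: Tinv_L2)

lemma opow_cong_left:
  assumes "opow (Tinv 1) k g h" "ae_eq g g'" "L2 g'" shows "opow (Tinv 1) k g' h"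
proof (cases k)
  case 0
  then show ?thesis using assms by (auto intro: ae_eq_trans)
next
  case (Suc j)
  then obtain y where y: "Tinv 1 g y" "opow (Tinv 1) j y h" using assms by auto
  then have "Tinv 1 g' y" using assms by (blast intro: Tinv_1_cong ae_eq_refl Tinv_L2)
  then show ?thesis using y Suc by auto
qed

lemma opow_functional:
  assumes "opow (Tinv 1) k g h" "opow (Tinv 1) k g h'" shows "ae_eq h h'"
  using assms
proof (induction k arbitrary: g)
  case 0
  then show ?case by (auto intro: ae_eq_trans ae_eq_sym)
next
  case (Suc k)
  then obtain y y' where y: "Tinv 1 g y" "opow (Tinv 1) k y h" "Tinv 1 g y'" "opow (Tinv 1) k y' h'"
    by auto
  have "opow (Tinv 1) k y h'"
    using y by (intro opow_cong_left[of k y' h' y] Tinv_1_functional) (auto dest: Tinv_L2)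
  then show ?case using Suc.IH y by blast
qed

lemma opow_diff:
  assumes "opow (Tinv 1) k g h" "opow (Tinv 1) k g' h'"
  shows "opow (Tinv 1) k (\<lambda>x. g x - g' x) (\<lambda>x. h x - h' x)"
  using assms
proof (induction k arbitrary: g g')
  case 0
  then show ?case by (auto intro: L2_diff ae_eq_diff)
next
  case (Suc k)
  then obtain y y' where "Tinv 1 g y" "opow (Tinv 1) k y h" "Tinv 1 g' y'" "opow (Tinv 1) k y' h'"
    by auto
  then show ?case using Suc.IH[of y y'] Tinv_1_diff[of g y g' y'] by auto
qed

lemma opow_cmult:
  assumes "opow (Tinv 1) k g h"
  shows "opow (Tinv 1) k (\<lambda>x. c * g x) (\<lambda>x. c * h x)"
  using assms
proof (induction k arbitrary: g)
  case 0
  then show ?case by (auto intro: L2_cmult ae_eq_cmult)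
next
  case (Suc k)
  then obtain y where "Tinv 1 g y" "opow (Tinv 1) k y h" by auto
  then show ?case using Suc.IH[of y] Tinv_1_cmult[of g y c] by auto
qed

lemma opow_Suc_imp: "opow (Tinv 1) (Suc k) g h \<Longrightarrow> \<exists>h'. opow (Tinv 1) k g h'"
proof (induction k arbitrary: g)
  case 0
  then show ?case by (auto dest: Tinv_L2 intro: ae_eq_refl)
next
  case (Suc k)
  then obtain y where y: "Tinv 1 g y" "opow (Tinv 1) (Suc k) y h" by auto
  then show ?case using Suc.IH[of y] by auto
qed

text \<open>The range of T_m lies in dom A^m. As A T_{m+1} h = T_m h - m T_{m+1} h, membership of
  T_{m+1} h in dom A^(j+1) follows from membership of T_m h and T_{m+1} h in dom A^j, which gives an
  inner induction on j.\<close>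

lemma opow_T: "L2 h \<Longrightarrow> \<exists>h'. opow (Tinv 1) m (T m h) h'"
proof (induction m)
  case 0
  then show ?case by (auto simp: T_0 intro: ae_eq_refl)
next
  case (Suc m)
  have "j \<le> m \<Longrightarrow> \<exists>h'. opow (Tinv 1) j (T m h) h'" for j
  proof (induction rule: inc_induct)
    case base
    then show ?case using Suc by blast
  next
    case (step n)
    then show ?case using opow_Suc_imp by blast
  qed
  note Tm = this
  have "j \<le> Suc m \<Longrightarrow> \<exists>h'. opow (Tinv 1) j (T (Suc m) h) h'" for j
  proof (induction j)
    case 0
    then show ?case using T_L2[OF Suc.prems] by (auto intro: ae_eq_refl)
  next
    case (Suc j)
    then obtain h1 h2 where h12: "opow (Tinv 1) j (T m h) h1" "opow (Tinv 1) j (T (Suc m) h) h2"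
      using Tm[of j] by auto
    have "opow (Tinv 1) j (\<lambda>x. T m h x - of_nat m * T (Suc m) h x) (\<lambda>x. h1 x - of_nat m * h2 x)"
      by (intro opow_diff opow_cmult h12)
    then show ?case using Tinv_1_T[OF \<open>L2 h\<close>, of m] by auto
  qed
  then show ?case by blast
qed

text \<open>Fixes all intermediate powers z_i = A^i g at once, as polynomials in A need them
  simultaneously.\<close>

lemma opow_imp_chain:
  "opow (Tinv 1) k g h \<Longrightarrow> \<exists>z. z 0 = g \<and> (\<forall>i<k. Tinv 1 (z i) (z (Suc i)))"
proof (induction k arbitrary: g)
  case 0
  then show ?case by (auto intro: exI[of _ "\<lambda>_. g"])
next
  case (Suc k)
  then obtain y where y: "Tinv 1 g y" "opow (Tinv 1) k y h" by auto
  then obtain z where z: "z 0 = y" "\<forall>i<k. Tinv 1 (z i) (z (Suc i))" using Suc.IH by blast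
  show ?case
    using y z by (intro exI[of _ "case_nat g z"]) (auto simp: less_Suc_eq_0_disj)
qed

lemma chain_imp_opow:
  "L2 (z k) \<Longrightarrow> (\<And>i. i < k \<Longrightarrow> Tinv 1 (z i) (z (Suc i))) \<Longrightarrow> opow (Tinv 1) k (z 0) (z k)"
proof (induction k arbitrary: z)
  case 0
  then show ?case by (simp add: ae_eq_refl)
next
  case (Suc k)
  have "opow (Tinv 1) k (z (Suc 0)) (z (Suc k))"
    using Suc.IH[of "\<lambda>i. z (Suc i)"] Suc.prems by simp
  then show ?case using Suc.prems by auto
qed

section \<open>The polynomial identity\<close>

text \<open>For a chain z_i = A^i g this is p(A) g when p has degree at most n. Summing to the fixed
  bound \<open>n\<close> instead of the degree makes it linear in p without case
  distinctions.\<close>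

definition poly_apply :: "nat \<Rightarrow> (nat \<Rightarrow> real \<Rightarrow> complex) \<Rightarrow> complex poly \<Rightarrow> real \<Rightarrow> complex" where
  "poly_apply n z p x = (\<Sum>i\<le>n. coeff p i * z i x)"

lemma poly_apply_1: "poly_apply n z 1 = z 0"
proof
  fix x
  have "poly_apply n z 1 x = (\<Sum>i\<le>n. if i = 0 then z 0 x else 0)"
    unfolding poly_apply_def by (intro sum.cong) (auto simp: coeff_1)
  then show "poly_apply n z 1 x = z 0 x" by simp
qed

text \<open>A p(A) g = ((X + c) p)(A) g - c p(A) g, since A shifts the chain by one place;
  \<open>degree p < n\<close> keeps the shift inside it. The form matches the recursion of the T_m
  h.\<close>

lemma Tinv_1_poly_apply:
  assumes z: "\<And>i. i < n \<Longrightarrow> Tinv 1 (z i) (z (Suc i))" and p: "degree p < n"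
  shows "Tinv 1 (poly_apply n z p) (\<lambda>x. poly_apply n z ([:c, 1:] * p) x - c * poly_apply n z p x)"
proof -
  have 1: "poly_apply n z p = (\<lambda>x. \<Sum>i<n. coeff p i * z i x)"
    using p by (auto simp: poly_apply_def coeff_eq_0 simp flip: lessThan_Suc_atMost)
  have 2: "poly_apply n z ([:c, 1:] * p) x - c * poly_apply n z p x = (\<Sum>i<n. coeff p i * z (Suc i) x)" for x
  proof -
    have "poly_apply n z ([:c, 1:] * p) x = c * poly_apply n z p x + (\<Sum>i\<le>n. coeff (pCons 0 p) i * z i x)"
      by (simp add: poly_apply_def algebra_simps sum.distrib sum_distrib_left)
    also have "(\<Sum>i\<le>n. coeff (pCons 0 p) i * z i x) = (\<Sum>i<n. coeff p i * z (Suc i) x)"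
      by (subst sum.atMost_shift) simp
    finally show ?thesis by simp
  qed
  have "Tinv 1 (\<lambda>x. \<Sum>i<n. coeff p i * z i x) (\<lambda>x. \<Sum>i<n. coeff p i * z (Suc i) x)"
    by (intro Tinv_1_sum Tinv_1_cmult z) simp
  then show ?thesis unfolding 2 by (subst 1)
qed

lemma degree_prod_linear: "degree (\<Prod>k\<in>A. [:of_nat k, 1:] :: complex poly) = card A"
  by (subst degree_prod_eq_sum_degree) auto

text \<open>Ascending comparison: if Y_m and T_m h agree, the difference w at level m + 1 satisfies
  A w = - m w and is therefore 0.\<close>

lemma Tinv_1_chain_eq_T:
  assumes h: "L2 h"
    and Y: "\<And>m. m < n \<Longrightarrow> Tinv 1 (Y (Suc m)) (\<lambda>x. Y m x - of_nat m * Y (Suc m) x)"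
    and "ae_eq (Y 0) h" "m \<le> n"
  shows "ae_eq (Y m) (T m h)"
  using \<open>m \<le> n\<close>
proof (induction m)
  case 0
  then show ?case using assms by (simp add: T_0)
next
  case (Suc m)
  define w where "w x = Y (Suc m) x - T (Suc m) h x" for x
  have w: "Tinv 1 w (\<lambda>x. (Y m x - of_nat m * Y (Suc m) x) - (T m h x - of_nat m * T (Suc m) h x))"
    unfolding w_def using Suc.prems by (intro Tinv_1_diff Y Tinv_1_T h) auto
  have "ae_eq (\<lambda>x. (Y m x - of_nat m * Y (Suc m) x) - (T m h x - of_nat m * T (Suc m) h x))
      (\<lambda>x. - of_nat m * w x)"
    using Suc unfolding ae_eq_def by (auto simp: w_def algebra_simps elim!: eventually_mono)
  then have "Tinv 1 w (\<lambda>x. - of_nat m * w x)"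
    by (rule Tinv_1_cong[OF w ae_eq_refl Tinv_L2(1)[OF w] _ L2_cmult[OF Tinv_L2(1)[OF w]]])
  then have "ae_eq w (\<lambda>_. 0)" by (rule Tinv_1_eigen)
  then show ?case unfolding ae_eq_def by eventually_elim (auto simp: w_def)
qed

text \<open>Descending comparison: if the two chains agree at level m + 1, single-valuedness of A
  forces agreement at level m.\<close>

lemma Tinv_1_chain_eq_T':
  assumes h: "L2 h"
    and Y: "\<And>m. m < n \<Longrightarrow> Tinv 1 (Y (Suc m)) (\<lambda>x. Y m x - of_nat m * Y (Suc m) x)"
    and Yn: "ae_eq (Y n) (T n h)"
  shows "ae_eq (Y 0) h"
proof -
  have "0 \<le> n \<Longrightarrow> ae_eq (Y 0) (T 0 h)"
  proof (induction rule: inc_induct)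
    case base
    show ?case by (rule Yn)
  next
    case (step m)
    have t: "Tinv 1 (Y (Suc m)) (\<lambda>x. T m h x - of_nat m * T (Suc m) h x)"
      using Tinv_1_T[OF h, of m] ae_eq_sym[OF step.IH] Tinv_L2(1)[OF Y[OF step.hyps(2)]]
      by (rule Tinv_1_cong) (use Tinv_L2(2)[OF Tinv_1_T[OF h]] in \<open>auto intro: ae_eq_refl\<close>)
    have "ae_eq (\<lambda>x. Y m x - of_nat m * Y (Suc m) x) (\<lambda>x. T m h x - of_nat m * T (Suc m) h x)"
      by (rule Tinv_1_functional[OF Y[OF step.hyps(2)] t])
    then show ?case using step.IH
      unfolding ae_eq_def by eventually_elim auto
  qed
  then show ?thesis by (simp add: T_0)
qed

text \<open>Interpolates between p_n at m = 0 and 1 at m = n, so that applied to g it links p_n(A) g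
  with g itself.\<close>

definition tail_factor :: "nat \<Rightarrow> nat \<Rightarrow> complex poly" where
  "tail_factor n m = (\<Prod>k\<in>{m..<n}. [:of_nat k, 1:])"

lemma tail_factor_0: "tail_factor n 0 = pn n"
  by (simp add: tail_factor_def pn_def atLeast0LessThan)

lemma tail_factor_self: "tail_factor n n = 1"
  by (simp add: tail_factor_def)

lemma degree_pn: "degree (pn n) = n"
  by (simp add: pn_def degree_prod_linear)

lemma Tinv_1_tail_factor:
  assumes z: "\<And>i. i < n \<Longrightarrow> Tinv 1 (z i) (z (Suc i))" and m: "m < n"
  shows "Tinv 1 (poly_apply n z (tail_factor n (Suc m)))
    (\<lambda>x. poly_apply n z (tail_factor n m) x - of_nat m * poly_apply n z (tail_factor n (Suc m)) x)"
proof -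
  have "tail_factor n m = [:of_nat m, 1:] * tail_factor n (Suc m)"
    using m unfolding tail_factor_def by (rule prod.atLeast_Suc_lessThan)
  moreover have "degree (tail_factor n (Suc m)) < n"
    using m by (simp add: tail_factor_def degree_prod_linear)
  ultimately show ?thesis using Tinv_1_poly_apply[where n = n and z = z, OF z] by metis
qed

lemma chain_L2:
  assumes "L2 (z 0)" "\<And>i. i < n \<Longrightarrow> Tinv 1 (z i) (z (Suc i))" "k \<le> n"
  shows "L2 (z k)"
proof (cases k)
  case (Suc i)
  then show ?thesis using Tinv_L2(2)[OF assms(2)[of i]] assms(3) by simp
qed (use assms in simp)

lemma opow_chain:
  assumes "L2 (z 0)" "\<And>i. i < n \<Longrightarrow> Tinv 1 (z i) (z (Suc i))" "k \<le> n"
  shows "opow (Tinv 1) k (z 0) (z k)"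
  using assms chain_L2[of z n k] by (intro chain_imp_opow) auto

theorem Tinv_iff_poly_op: "Tinv n g h \<longleftrightarrow> poly_op (pn n) (Tinv 1) g h"
proof
  assume gh: "Tinv n g h"
  then have L: "L2 g" "L2 h" and Tg: "ae_eq (T n h) g" by (auto simp: Tinv_def)
  obtain h' where "opow (Tinv 1) n g h'"
    using opow_T[OF L(2), of n] opow_cong_left[OF _ Tg L(1)] by blast
  then obtain z where z: "z 0 = g" "\<And>i. i < n \<Longrightarrow> Tinv 1 (z i) (z (Suc i))"
    using opow_imp_chain by blast
  have "ae_eq (poly_apply n z (tail_factor n 0)) h"
  proof (rule Tinv_1_chain_eq_T'[OF L(2), of n])
    show "ae_eq (poly_apply n z (tail_factor n n)) (T n h)"
      using Tg z(1) by (simp add: tail_factor_self poly_apply_1 ae_eq_sym)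
  qed (rule Tinv_1_tail_factor[where n = n and z = z, OF z(2)])
  then have "ae_eq h (\<lambda>x. \<Sum>k\<le>n. coeff (pn n) k * z k x)"
    by (simp add: tail_factor_0 poly_apply_def[abs_def] ae_eq_sym)
  moreover have "opow (Tinv 1) k g (z k)" if "k \<le> n" for k
    using opow_chain[of z n k] z L that by simp
  ultimately show "poly_op (pn n) (Tinv 1) g h"
    using L by (auto simp: poly_op_def degree_pn)
next
  assume "poly_op (pn n) (Tinv 1) g h"
  then obtain ys where h: "L2 h" "ae_eq h (\<lambda>x. \<Sum>k\<le>n. coeff (pn n) k * ys k x)"
    and ys: "\<And>k. k \<le> n \<Longrightarrow> opow (Tinv 1) k g (ys k)"
    by (auto simp: poly_op_def degree_pn)
  have g: "L2 g" using ys[of n] by (auto dest: opow_L2)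
  obtain z where z: "z 0 = g" "\<And>i. i < n \<Longrightarrow> Tinv 1 (z i) (z (Suc i))"
    using opow_imp_chain[OF ys[OF order_refl]] by blast
  \<comment> \<open>\<open>poly_op\<close> picks a representative of each power separately;
    single-valued powers identify them with one common chain.\<close>
  have "ae_eq (ys k) (z k)" if "k \<le> n" for k
    using opow_functional[OF ys[OF that]] opow_chain[of z n k] z g that by simp
  then have "ae_eq (\<lambda>x. \<Sum>k\<le>n. coeff (pn n) k * ys k x) (poly_apply n z (tail_factor n 0))"
    unfolding tail_factor_0 poly_apply_def[abs_def] by (intro ae_eq_sum ae_eq_cmult) auto
  with h(2) have "ae_eq (poly_apply n z (tail_factor n 0)) h"
    by (blast intro: ae_eq_trans ae_eq_sym)
  then have "ae_eq (poly_apply n z (tail_factor n n)) (T n h)"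
    by (intro Tinv_1_chain_eq_T[where n = n and Y = "\<lambda>m. poly_apply n z (tail_factor n m)"] h(1)
        Tinv_1_tail_factor[where n = n and z = z, OF z(2)] order_refl)
  then show "Tinv n g h"
    using g h z(1) by (simp add: Tinv_def tail_factor_self poly_apply_1 ae_eq_sym)
qed

text \<open>As p_n has degree n, the natural domain of p_n(A) is dom A^n.\<close>

lemma opdom_opow_Tinv_1: "opdom (opow (Tinv 1) n) = opdom (Tinv n)"
proof (intro equalityI subsetI)
  fix g assume "g \<in> opdom (opow (Tinv 1) n)"
  then obtain h where h: "opow (Tinv 1) n g h" by (auto simp: opdom_def)
  then obtain z where z: "z 0 = g" "\<And>i. i < n \<Longrightarrow> Tinv 1 (z i) (z (Suc i))"
    using opow_imp_chain by blast
  have g: "L2 g" using h by (rule opow_L2)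
  have "L2 (\<lambda>x. \<Sum>k\<le>n. coeff (pn n) k * z k x)"
  proof (intro L2_sum L2_cmult)
    fix k assume "k \<in> {..n}"
    then show "L2 (z k)" using g z by (intro chain_L2[of z n k]) auto
  qed
  moreover have "opow (Tinv 1) k g (z k)" if "k \<le> n" for k
    using opow_chain[of z n k] z g that by simp
  ultimately have "poly_op (pn n) (Tinv 1) g (\<lambda>x. \<Sum>k\<le>n. coeff (pn n) k * z k x)"
    by (auto simp: poly_op_def degree_pn intro: ae_eq_refl)
  then show "g \<in> opdom (Tinv n)" by (auto simp: opdom_def Tinv_iff_poly_op)
next
  fix g assume "g \<in> opdom (Tinv n)"
  then show "g \<in> opdom (opow (Tinv 1) n)"
    by (force simp: opdom_def Tinv_iff_poly_op poly_op_def degree_pn)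
qed

section \<open>The domain\<close>

lemma L2_cong:
  assumes "L2 f" "\<And>x. x > 0 \<Longrightarrow> f x = g x" shows "L2 g"
proof -
  have "(\<lambda>x. indicator {0<..} x *\<^sub>R f x) = (\<lambda>x. indicator {0<..} x *\<^sub>R g x)"
    using assms(2) by (intro ext) (auto split: split_indicator)
  moreover have "(\<lambda>x. indicator {0<..} x *\<^sub>R (cmod (f x))^2) = (\<lambda>x. indicator {0<..} x *\<^sub>R (cmod (g x))^2)"
    using assms(2) by (intro ext) (auto split: split_indicator)
  ultimately show ?thesis
    using assms(1) by (simp add: L2_def set_borel_measurable_def set_integrable_def)
qed

text \<open>The conditions of \<open>Dn\<close> in a form fit for induction: writing
  \<open>Suc j = n\<close> instead of \<open>n - 1\<close> makes n = 0 meaningful, and j = 0 is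
  added to the weighted conditions so that \<open>d 0\<close> is itself in L2.\<close>

definition sobolev_chain :: "nat \<Rightarrow> (nat \<Rightarrow> real \<Rightarrow> complex) \<Rightarrow> bool" where
  "sobolev_chain n d \<longleftrightarrow> (\<forall>j<n. ac_loc (d j)) \<and>
    (\<forall>j. Suc j < n \<longrightarrow> (\<forall>x>0. (d j has_vector_derivative d (Suc j) x) (at x))) \<and>
    (\<forall>j. Suc j = n \<longrightarrow> (AE x in lborel. x > 0 \<longrightarrow> (d j has_vector_derivative d (Suc j) x) (at x))) \<and>
    (\<forall>j\<le>n. L2 (\<lambda>x. of_real x ^ j * d j x))"

lemma sobolev_chain_AE:
  assumes "sobolev_chain n d"
  shows "AE x in lborel. x > 0 \<longrightarrow> (\<forall>j<n. (d j has_vector_derivative d (Suc j) x) (at x))"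
proof (cases n)
  case (Suc m)
  have ev: "(d j has_vector_derivative d (Suc j) x) (at x)" if "j < m" "x > 0" for j x
    using assms Suc that by (simp add: sobolev_chain_def)
  have "AE x in lborel. x > 0 \<longrightarrow> (d m has_vector_derivative d (Suc m) x) (at x)"
    using assms Suc by (simp add: sobolev_chain_def)
  then show ?thesis
    by eventually_elim (use ev Suc in \<open>auto simp: less_Suc_eq\<close>)
qed simp

lemma sobolev_chain_L2: "sobolev_chain n d \<Longrightarrow> L2 (d 0)"
  unfolding sobolev_chain_def by (auto dest: spec[where x = 0])

text \<open>For n >= 1 the function \<open>d 0\<close> is continuous, hence measurable, and so
  inherits square integrability from \<open>g\<close>.\<close>

lemma Dn_iff:
  assumes "n \<ge> 1"
  shows "g \<in> Dn n \<longleftrightarrow> L2 g \<and> (\<exists>d. ae_eq g (d 0) \<and> sobolev_chain n d)"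
proof -
  obtain m where m: "n = Suc m" using assms by (cases n) auto
  have "L2 g \<Longrightarrow> ae_eq g (d 0) \<Longrightarrow> ac_loc (d 0) \<Longrightarrow> L2 (d 0)" for d :: "nat \<Rightarrow> real \<Rightarrow> complex"
    by (rule L2_cong_AE[OF _ _ continuous_on_set_borel_measurable[OF ac_loc_imp_continuous_on]])
  moreover have "(\<forall>j\<le>n. P j) \<longleftrightarrow> P 0 \<and> (\<forall>j\<in>{1..n}. P j)" for P
    by (metis One_nat_def Suc_leI atLeastAtMost_iff le0 neq0_conv)
  ultimately show ?thesis
    unfolding Dn_def sobolev_chain_def by (auto simp: m)
qed

lemma ac_loc_integral: "L2 f \<Longrightarrow> ac_loc (\<lambda>x. integral {0..x} f)"
  by (simp add: ac_loc_def L2_integral_ac_on)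

lemma of_real_has_vector_derivative: "(complex_of_real has_vector_derivative 1) (at x)"
  using has_vector_derivative_real_field[of "\<lambda>z. z" 1 x UNIV] by simp

lemma inverse_has_vector_derivative:
  "x > 0 \<Longrightarrow> ((\<lambda>t. 1 / complex_of_real t) has_vector_derivative - (1 / of_real x ^ 2)) (at x)"
proof (rule has_vector_derivative_real_field)
  assume "x > 0"
  then show "((\<lambda>z. 1 / z) has_field_derivative - (1 / of_real x ^ 2)) (at (complex_of_real x))"
    by (auto intro!: derivative_eq_intros simp: power2_eq_square)
qed

text \<open>If \<open>e\<close> lists the derivatives of \<open>y\<close>, this lists those of \<open>x\<inverse> \<integral>\<^sub>0\<^sup>x y\<close>:
  differentiate \<open>x d\<^sub>0' + d\<^sub>0 = e\<^sub>0\<close> repeatedly.\<close>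
primrec average_chain :: "(nat \<Rightarrow> real \<Rightarrow> complex) \<Rightarrow> nat \<Rightarrow> real \<Rightarrow> complex" where
  "average_chain e 0 = (\<lambda>x. integral {0..x} (e 0) * (1 / of_real x))"
| "average_chain e (Suc j) = (\<lambda>x. (e j x + (- of_nat (Suc j)) * average_chain e j x) * (1 / of_real x))"

text \<open>Stated at a single point x, so that it serves both the classical derivatives and the
  a.e. derivative of top order.\<close>

lemma average_chain_deriv:
  assumes x: "x > 0"
    and 0: "((\<lambda>x. integral {0..x} (e 0)) has_vector_derivative e 0 x) (at x)"
    and e: "\<And>i. i < j \<Longrightarrow> (e i has_vector_derivative e (Suc i) x) (at x)"
  shows "(average_chain e j has_vector_derivative average_chain e (Suc j) x) (at x)"
  using e
proof (induction j)
  case 0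
  have "(average_chain e 0 has_vector_derivative
      (integral {0..x} (e 0) * (- (1 / of_real x ^ 2)) + e 0 x * (1 / of_real x))) (at x)"
    unfolding average_chain.simps
    by (rule has_vector_derivative_mult[OF \<open>((\<lambda>x. integral {0..x} (e 0)) has_vector_derivative e 0 x) (at x)\<close>
        inverse_has_vector_derivative[OF x]])
  also have "integral {0..x} (e 0) * (- (1 / of_real x ^ 2)) + e 0 x * (1 / of_real x) = average_chain e (Suc 0) x"
    using x by (simp add: power2_eq_square field_simps)
  finally show ?case .
next
  case (Suc j)
  have d: "(average_chain e j has_vector_derivative average_chain e (Suc j) x) (at x)"
    using Suc by simp
  have "(average_chain e (Suc j) has_vector_derivative
      ((e j x + (- of_nat (Suc j)) * average_chain e j x) * (- (1 / of_real x ^ 2)) +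
       (e (Suc j) x + (- of_nat (Suc j)) * average_chain e (Suc j) x) * (1 / of_real x))) (at x)"
    unfolding average_chain.simps(2)[of e j]
    by (intro has_vector_derivative_mult inverse_has_vector_derivative x has_vector_derivative_add
        Suc.prems has_vector_derivative_mult_right d[unfolded average_chain.simps(2)]) simp
  \<comment> \<open>Differentiating the factor 1/x reproduces the current entry with coefficient -1,
    which raises j + 1 to j + 2.\<close>
  also have "(e j x + (- of_nat (Suc j)) * average_chain e j x) * (- (1 / of_real x ^ 2)) =
      - (average_chain e (Suc j) x * (1 / of_real x))"
    by (simp add: power2_eq_square)
  also have "- (average_chain e (Suc j) x * (1 / of_real x)) +
      (e (Suc j) x + (- of_nat (Suc j)) * average_chain e (Suc j) x) * (1 / of_real x) =
      average_chain e (Suc (Suc j)) x"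
    unfolding average_chain.simps(2)[of e "Suc j"] of_nat_Suc
    by (simp add: algebra_simps del: average_chain.simps)
  finally show ?case .
qed

text \<open>T_1 gains one order of regularity. The weighted bounds follow inductively from x^(j+1)
  d_{j+1} = x^j e_j - (j+1) x^j d_j.\<close>

lemma sobolev_chain_average:
  assumes gy: "Tinv 1 g y" and ye: "ae_eq y (e 0)" and e: "sobolev_chain n e"
  shows "ae_eq g (average_chain e 0)" "sobolev_chain (Suc n) (average_chain e)"
proof -
  have L: "L2 (e 0)" using e by (rule sobolev_chain_L2)
  have "AE x in lborel. x > 0 \<longrightarrow> integral {0..x} (e 0) = of_real x * g x"
    using gy ae_eq_imp_integral_eq[OF ye] by (simp add: Tinv_1_iff)
  then show gd: "ae_eq g (average_chain e 0)"
    unfolding ae_eq_def by eventually_elim (auto simp: field_simps)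
  have ac: "j \<le> n \<Longrightarrow> ac_loc (average_chain e j)" for j
  proof (induction j)
    case 0
    show ?case by (simp only: average_chain.simps) (intro ac_loc_mult ac_loc_integral L ac_loc_inverse)
  next
    case (Suc j)
    then show ?case using e
      by (simp only: average_chain.simps)
        (intro ac_loc_mult ac_loc_add ac_loc_const ac_loc_inverse, auto simp: sobolev_chain_def)
  qed
  have deriv: "(average_chain e j has_vector_derivative average_chain e (Suc j) x) (at x)"
    if "j < n" "x > 0" for j x
  proof (rule average_chain_deriv[OF \<open>x > 0\<close>])
    have "ac_loc (e 0)" using e that by (auto simp: sobolev_chain_def)
    then show "((\<lambda>x. integral {0..x} (e 0)) has_vector_derivative e 0 x) (at x)"
      by (intro L2_has_vector_derivative_integral L that ac_loc_imp_continuous_on)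
  qed (use e that in \<open>auto simp: sobolev_chain_def\<close>)
  have deriv_AE: "AE x in lborel. x > 0 \<longrightarrow>
      (average_chain e n has_vector_derivative average_chain e (Suc n) x) (at x)"
    using L2_AE_has_vector_derivative_integral[OF L] sobolev_chain_AE[OF e]
    by eventually_elim (auto intro!: average_chain_deriv simp del: average_chain.simps)
  have L2d: "j \<le> Suc n \<Longrightarrow> L2 (\<lambda>x. of_real x ^ j * average_chain e j x)" for j
  proof (induction j)
    case 0
    have "L2 (average_chain e 0)"
      using gy by (intro L2_cong_AE[OF _ gd] continuous_on_set_borel_measurable
          ac_loc_imp_continuous_on ac) (auto dest: Tinv_L2)
    then show ?case by simp
  next
    case (Suc j)
    have "L2 (\<lambda>x. of_real x ^ j * e j x + (- of_nat (Suc j)) * (of_real x ^ j * average_chain e j x))"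
      using e Suc by (intro L2_add L2_cmult) (auto simp: sobolev_chain_def)
    then show ?case by (rule L2_cong) (simp add: field_simps)
  qed
  show "sobolev_chain (Suc n) (average_chain e)"
    unfolding sobolev_chain_def using ac deriv deriv_AE L2d
    by (auto simp del: average_chain.simps simp: less_Suc_eq_le)
qed

text \<open>Otherwise \<open>u\<close> would behave like \<open>c / x\<close> at 0, whose mass on \<open>[x/2, x]\<close> does not tend to 0.\<close>
lemma L2_boundary_value_zero:
  assumes u: "L2 u" and v: "L2 v"
    and eq: "\<And>x. x > 0 \<Longrightarrow> of_real x * u x = c + integral {0..x} v"
  shows "c = 0"
proof (rule ccontr)
  assume "c \<noteq> 0"
  let ?U = "\<lambda>x. integral {0..x} (\<lambda>t. cmod (u t))" and ?V = "\<lambda>x. integral {0..x} v"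
  have contU: "continuous_on {0..} ?U"
    by (intro continuous_on_integral_from_0 L2_integrable_on u) simp
  have contV: "continuous_on {0..} ?V" by (rule L2_integral_continuous_on[OF v])
  \<comment> \<open>Thresholds: |V| < |c|/2 leaves t |u(t)| >= |c|/2, so |u| >= |c|/(2x) on [x/2,x].
    The integral of |u| there is at least |c|/4, contradicting the bound on
    \<open>?U\<close>.\<close>
  obtain d1 where d1: "d1 > 0" "\<And>x. x \<ge> 0 \<Longrightarrow> dist x 0 \<le> d1 \<Longrightarrow> dist (?U x) (?U 0) < cmod c / 4"
    by (rule continuous_onE[OF contU, of 0 "cmod c / 4"]) (use \<open>c \<noteq> 0\<close> that in auto)
  obtain d2 where d2: "d2 > 0" "\<And>x. x \<ge> 0 \<Longrightarrow> dist x 0 \<le> d2 \<Longrightarrow> dist (?V x) (?V 0) < cmod c / 2"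
    by (rule continuous_onE[OF contV, of 0 "cmod c / 2"]) (use \<open>c \<noteq> 0\<close> that in auto)
  define x where "x = min d1 d2 / 2"
  have x: "x > 0" "x < d1" "x < d2" using d1(1) d2(1) by (auto simp: x_def min_def)
  have "cmod c / (2 * x) \<le> cmod (u t)" if t: "t \<in> {x/2..x}" for t
  proof -
    have t0: "t > 0" "t \<le> x" using t x by auto
    have "cmod (?V t) < cmod c / 2" using d2(2)[of t] t0 x by (simp add: dist_norm)
    then have "cmod c / 2 \<le> cmod (c + ?V t)"
      using norm_diff_ineq[of c "?V t"] by linarith
    also have "\<dots> = t * cmod (u t)"
      using t0 by (simp add: norm_mult flip: eq)
    also have "\<dots> \<le> x * cmod (u t)" using t0 by (intro mult_right_mono) auto
    finally show ?thesis using x by (simp add: field_simps)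
  qed
  then have "integral {x/2..x} (\<lambda>_. cmod c / (2 * x)) \<le> integral {x/2..x} (\<lambda>t. cmod (u t))"
    using x by (intro integral_le L2_integrable_on u integrable_const_ivl) auto
  also have "\<dots> \<le> ?U x"
    using x by (intro integral_subset_le L2_integrable_on u) auto
  also have "\<dots> < cmod c / 4" using d1(2)[of x] x by (simp add: dist_norm)
  finally show False using x by simp
qed

text \<open>By Leibniz, \<open>e j\<close> is the j-th derivative of (x g)' = x g' + g. So x g
  differs from the primitive of \<open>e 0\<close> by a constant, and membership in the graph of A
  amounts to this constant being 0.\<close>

lemma Tinv_1_sobolev_chain:
  assumes g: "L2 g" and gd: "ae_eq g (d 0)" and d: "sobolev_chain (Suc n) d"
  defines "e \<equiv> \<lambda>j x. of_real x * d (Suc j) x + of_nat (Suc j) * d j x"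
  shows "Tinv 1 g (e 0)" "sobolev_chain n e"
proof -
  have ac: "ac_loc (d j)" if "j \<le> n" for j using d that by (auto simp: sobolev_chain_def)
  have deriv_e: "(e j has_vector_derivative e (Suc j) x) (at x)"
    if "(d j has_vector_derivative d (Suc j) x) (at x)"
      "(d (Suc j) has_vector_derivative d (Suc (Suc j)) x) (at x)" for j x
  proof -
    have "(e j has_vector_derivative (of_real x * d (Suc (Suc j)) x + 1 * d (Suc j) x) +
        of_nat (Suc j) * d (Suc j) x) (at x)"
      unfolding e_def
      by (intro has_vector_derivative_add has_vector_derivative_mult has_vector_derivative_mult_right
          of_real_has_vector_derivative that)
    then show ?thesis by (simp add: e_def algebra_simps)
  qed
  have L2e: "L2 (\<lambda>x. of_real x ^ j * e j x)" if "j \<le> n" for j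
  proof -
    have "L2 (\<lambda>x. of_real x ^ Suc j * d (Suc j) x + of_nat (Suc j) * (of_real x ^ j * d j x))"
      using d that by (intro L2_add L2_cmult) (auto simp: sobolev_chain_def)
    then show ?thesis by (rule L2_cong) (simp add: e_def algebra_simps)
  qed
  show "sobolev_chain n e"
    unfolding sobolev_chain_def
  proof (intro conjI allI impI)
    fix j assume "j < n"
    then show "ac_loc (e j)"
      unfolding e_def by (intro ac_loc_add ac_loc_mult ac_loc_of_real ac_loc_const ac) auto
  next
    fix j x assume "Suc j < n" "0 < (x :: real)"
    then show "(e j has_vector_derivative e (Suc j) x) (at x)"
      using d by (intro deriv_e) (auto simp: sobolev_chain_def)
  next
    fix j assume j: "Suc j = n"
    show "AE x in lborel. 0 < x \<longrightarrow> (e j has_vector_derivative e (Suc j) x) (at x)"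
      using sobolev_chain_AE[OF d] by eventually_elim (use j in \<open>auto intro!: deriv_e\<close>)
  qed (rule L2e)
  have Le: "L2 (e 0)" using L2e[of 0] by simp
  \<comment> \<open>F is absolutely continuous with a.e. derivative \<open>e 0\<close>; for n = 0
    the derivative is known only a.e., which is why the fundamental theorem for absolutely
    continuous functions is used.\<close>
  define F where "F x = of_real x * d 0 x" for x
  have acF: "ac_loc F" unfolding F_def by (intro ac_loc_mult ac_loc_of_real ac) simp
  have "AE x in lborel. x > 0 \<longrightarrow> (F has_vector_derivative e 0 x) (at x)"
    using sobolev_chain_AE[OF d]
  proof eventually_elim
    case (elim x)
    show ?case
    proof
      assume "x > 0"
      then have "(d 0 has_vector_derivative d (Suc 0) x) (at x)" using elim by simp
      then have "(F has_vector_derivative of_real x * d (Suc 0) x + 1 * d 0 x) (at x)"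
        unfolding F_def by (intro has_vector_derivative_mult of_real_has_vector_derivative)
      then show "(F has_vector_derivative e 0 x) (at x)" by (simp add: e_def)
    qed
  qed
  note derivF = this
  have diff: "F b - F a = integral {0..b} (e 0) - integral {0..a} (e 0)" if ab: "0 < a" "a \<le> b" for a b
  proof -
    have "(e 0 has_integral F b - F a) {a..b}"
    proof (rule fundamental_theorem_of_calculus_ac[OF ab(2)])
      show "ac_on a b F" using acF ab by (simp add: ac_loc_def)
      show "AE x in lborel. a < x \<and> x < b \<longrightarrow> (F has_vector_derivative e 0 x) (at x)"
        using derivF by eventually_elim (use ab in auto)
    qed
    then have 1: "integral {a..b} (e 0) = F b - F a" by (rule integral_unique)
    have 2: "integral {0..a} (e 0) + integral {a..b} (e 0) = integral {0..b} (e 0)"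
      using ab by (intro Henstock_Kurzweil_Integration.integral_combine L2_integrable_on Le) auto
    show ?thesis by (simp only: 1[symmetric] 2[symmetric] add_diff_cancel_left')
  qed
  \<comment> \<open>The boundary value of x g(x) at 0, read off at the reference point 1.\<close>
  define c where "c = F 1 - integral {0..1} (e 0)"
  have c: "of_real x * d 0 x = c + integral {0..x} (e 0)" if "x > 0" for x
    using diff[of 1 x] diff[of x 1] that unfolding c_def F_def[symmetric]
    by (cases "x \<le> 1") (auto simp: algebra_simps)
  have "c = 0" by (rule L2_boundary_value_zero[OF sobolev_chain_L2[OF d] Le c])
  then show "Tinv 1 g (e 0)"
    unfolding Tinv_1_iff using g Le gd c
    by (auto simp: ae_eq_def elim!: eventually_mono)
qed

text \<open>g lies in dom A^(n+1) exactly when A g exists and lies in dom A^n. The induction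
  therefore runs over all g, and the two chain constructions translate between the derivatives of g
  and of A g.\<close>

theorem opow_domain:
  "(\<exists>h. opow (Tinv 1) n g h) \<longleftrightarrow> L2 g \<and> (\<exists>d. ae_eq g (d 0) \<and> sobolev_chain n d)"
proof (induction n arbitrary: g)
  case 0
  show ?case
  proof (intro iffI)
    assume "\<exists>h. opow (Tinv 1) 0 g h"
    then show "L2 g \<and> (\<exists>d. ae_eq g (d 0) \<and> sobolev_chain 0 d)"
      by (auto simp: sobolev_chain_def intro!: exI[of _ "\<lambda>_. g"] ae_eq_refl)
  qed (auto intro: ae_eq_refl)
next
  case (Suc n)
  show ?case
  proof
    assume "\<exists>h. opow (Tinv 1) (Suc n) g h"
    then obtain y h where y: "Tinv 1 g y" "opow (Tinv 1) n y h" by auto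
    then obtain e where "ae_eq y (e 0)" "sobolev_chain n e" using Suc.IH by blast
    with y(1) show "L2 g \<and> (\<exists>d. ae_eq g (d 0) \<and> sobolev_chain (Suc n) d)"
      using sobolev_chain_average Tinv_L2 by blast
  next
    assume "L2 g \<and> (\<exists>d. ae_eq g (d 0) \<and> sobolev_chain (Suc n) d)"
    then obtain d where g: "L2 g" "ae_eq g (d 0)" "sobolev_chain (Suc n) d" by blast
    define e where "e j x = of_real x * d (Suc j) x + of_nat (Suc j) * d j x" for j x
    have e: "Tinv 1 g (e 0)" "sobolev_chain n e"
      using Tinv_1_sobolev_chain[OF g] by (simp_all only: e_def[abs_def])
    then have "\<exists>h. opow (Tinv 1) n (e 0) h"
      using Suc.IH sobolev_chain_L2 ae_eq_refl by blast
    then show "\<exists>h. opow (Tinv 1) (Suc n) g h" using e by auto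
  qed
qed

theorem theorem7p5:
  fixes n :: nat
  assumes "n \<ge> 1"
  shows "(\<forall>g h. Tinv n g h \<longleftrightarrow> poly_op (pn n) (Tinv 1) g h)
       \<and> opdom (Tinv n) = opdom (opow (Tinv 1) n)
       \<and> opdom (opow (Tinv 1) n) = Dn n"
proof (intro conjI allI)
  show "opdom (opow (Tinv 1) n) = Dn n"
    by (auto simp: opdom_def opow_domain Dn_iff[OF assms])
qed (simp_all only: Tinv_iff_poly_op opdom_opow_Tinv_1)

end
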